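(* Let $\alpha_1,\alpha_3,\alpha_4\in\mathbb{F}_{p^m}^*$ be such that $\alpha_1+\alpha_3v+\alpha_4uv$ is not a cube in $\mathcal{R}$, and let $R_{\alpha_1,\alpha_3,\alpha_4}=\frac{\mathcal{R}[x]}{\langle x^{3p^s}-(\alpha_1+\alpha_3v+\alpha_4uv)\rangle}$. Then the ideals of $R_{\alpha_1,\alpha_3,\alpha_4}$ are exactly the following. Type A (trivial ideals): $\langle 0\rangle$, $\langle 1\rangle$. Type B (principal ideals with nonmonic generators): $\langle u(x^3-\alpha_0)^\ell\rangle$, where $0\le \ell\le 2p^s-1$. Type C (principal ideals with monic generators): $\langle (x^3-\alpha_0)^\ell+u(x^3-\alpha_0)^t z(x)\rangle$, where $1\le\ell\le 2p^s-1$, $0\le t<\ell$, and either $z(x)=0$ or $z(x)$ is invertible and can be written as a finite sum $z(x)=\sum_{\kappa\ge 0}(z_{0\kappa}x^2+z_{1\kappa}x+z_{2\kappa})(x^3-\alpha_0)^\kappa$ with $z_{0\kappa},z_{1\kappa},z_{2\kappa}\in\mathbb{F}_{p^m}$ and $z_{00}x^2+z_{10}x+z_{20}\ne0$. Type D (non-principal ideals): $\langle (x^3-\alpha_0)^\ell+u\sum_{\kappa=0}^{\mu-1}(a_\kappa x^2+b_\kappa x+c_\kappa)(x^3-\alpha_0)^\kappa,\ u(x^3-\alpha_0)^\mu\rangle$, where $0\le\ell\le 2p^s-1$, $a_\kappa,b_\kappa,c_\kappa\in\mathbb{F}_{p^m}$, and $0\le \mu<\Im$, with $\Im$ the smallest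 non-negative integer such that $u(x^3-\alpha_0)^{\Im}\in\langle (x^3-\alpha_0)^\ell+u\sum_{\kappa=0}^{\mu-1}(a_\kappa x^2+b_\kappa x+c_\kappa)(x^3-\alpha_0)^\kappa\rangle$; equivalently, $\langle (x^3-\alpha_0)^\ell+u(x^3-\alpha_0)^tz(x),\ u(x^3-\alpha_0)^\mu\rangle$ with $z(x)$ as in Type C and involving only powers $(x^3-\alpha_0)^\kappa$ with $\kappa\le\mu-t-1$.
   Context: $p\neq3$ is a prime, $m,s$ are positive integers, and $\mathcal{R}=\frac{\mathbb{F}_{p^m}[u,v]}{\langle u^2,v^2,uv-vu\rangle}=\mathbb{F}_{p^m}+u\mathbb{F}_{p^m}+v\mathbb{F}_{p^m}+uv\mathbb{F}_{p^m}$ with $u^2=v^2=0$, $uv=vu$. Writing $s=q_0m+r_0$ with $q_0\ge0$ and $0\le r_0\le m-1$, put $\alpha_0=\alpha_1^{p^{m-r_0}}\in\mathbb{F}_{p^m}^*$, so that $\alpha_0^{p^s}=\alpha_1$. The ideals of $R_{\alpha_1,\alpha_3,\alpha_4}$ are the $(\alpha_1+\alpha_3v+\alpha_4uv)$-constacyclic codes of length $3p^s$ over $\mathcal{R}$. *)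

theory Defs
  imports "HOL-Algebra.Algebraic_Closure_Type"
begin

section \<open>The ring \<open>R = F[u,v]/\<langle>u\<^sup>2, v\<^sup>2, uv - vu\<rangle>\<close>\<close>

text \<open>
  \<open>F[u,v]\<close> is the iterated polynomial ring \<open>(F[u])[v]\<close>. Since it is commutative, the
  generator \<open>uv - vu\<close> is zero, and \<open>R\<close> is its quotient by \<open>\<langle>u\<^sup>2, v\<^sup>2\<rangle>\<close>.
\<close>

abbreviation u_ind :: "'a::field poly poly" where
  "u_ind \<equiv> [:[:0, 1:]:]"

abbreviation v_ind :: "'a::field poly poly" where
  "v_ind \<equiv> [:0, 1:]"

definition uv_rel :: "'a::field poly poly \<Rightarrow> 'a poly poly \<Rightarrow> bool" where
  "uv_rel P Q \<longleftrightarrow> (\<exists>A B. P - Q = A * u_ind ^ 2 + B * v_ind ^ 2)"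

lemma uv_rel_refl: "uv_rel P P"
  unfolding uv_rel_def by (intro exI[of _ 0]) simp

lemma uv_rel_sym:
  assumes "uv_rel P Q"
  shows "uv_rel Q P"
proof -
  obtain A B where "P - Q = A * u_ind ^ 2 + B * v_ind ^ 2"
    using assms by (auto simp: uv_rel_def)
  hence "Q - P = (- A) * u_ind ^ 2 + (- B) * v_ind ^ 2"
    by (metis (no_types, opaque_lifting) minus_diff_eq minus_add_distrib mult_minus_left)
  thus ?thesis unfolding uv_rel_def by blast
qed

lemma uv_rel_add:
  assumes "uv_rel P Q" "uv_rel P' Q'"
  shows "uv_rel (P + P') (Q + Q')"
proof -
  obtain A B A' B' where "P - Q = A * u_ind ^ 2 + B * v_ind ^ 2"
    "P' - Q' = A' * u_ind ^ 2 + B' * v_ind ^ 2"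
    using assms unfolding uv_rel_def by blast
  moreover have "(P + P') - (Q + Q') = (P - Q) + (P' - Q')" by (rule add_diff_add)
  ultimately have "(P + P') - (Q + Q') = (A + A') * u_ind ^ 2 + (B + B') * v_ind ^ 2"
    by (simp only: distrib_right ac_simps)
  thus ?thesis unfolding uv_rel_def by blast
qed

lemma uv_rel_mult_left:
  assumes "uv_rel P Q"
  shows "uv_rel (C * P) (C * Q)"
proof -
  obtain A B where "P - Q = A * u_ind ^ 2 + B * v_ind ^ 2"
    using assms unfolding uv_rel_def by blast
  hence "C * P - C * Q = (C * A) * u_ind ^ 2 + (C * B) * v_ind ^ 2"
    by (simp only: right_diff_distrib[symmetric] distrib_left mult.assoc)
  thus ?thesis unfolding uv_rel_def by blast
qed

lemma uv_rel_trans: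
  assumes "uv_rel P Q" "uv_rel Q S"
  shows "uv_rel P S"
proof -
  have "uv_rel (P + (Q + - Q)) (Q + (S + - Q))"
    by (intro uv_rel_add assms uv_rel_refl)
  thus ?thesis by simp
qed

lemma uv_rel_mult:
  assumes "uv_rel P Q" "uv_rel P' Q'"
  shows "uv_rel (P * P') (Q * Q')"
proof -
  have "uv_rel (P' * P) (P' * Q)" "uv_rel (Q * P') (Q * Q')"
    using assms by (auto intro: uv_rel_mult_left)
  thus ?thesis by (metis mult.commute uv_rel_trans)
qed

lemma uv_rel_uminus:
  assumes "uv_rel P Q"
  shows "uv_rel (- P) (- Q)"
  using uv_rel_mult_left[OF assms, of "-1"] by simp

lemma not_uv_rel_0_1: "\<not> uv_rel (0 :: 'a::field poly poly) 1"
proof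
  assume "uv_rel (0 :: 'a poly poly) 1"
  then obtain A B :: "'a poly poly" where "0 - 1 = A * u_ind ^ 2 + B * v_ind ^ 2"
    unfolding uv_rel_def by blast
  hence "poly (poly (0 - 1) 0) 0 = poly (poly (A * u_ind ^ 2 + B * v_ind ^ 2) 0) 0"
    by (simp only:)
  thus False by simp
qed

quotient_type (overloaded) 'a fuv = "'a::field poly poly" / uv_rel
  by (intro equivpI reflpI sympI transpI) (auto intro: uv_rel_refl uv_rel_sym uv_rel_trans)

instantiation fuv :: (field) comm_ring_1
begin

lift_definition zero_fuv :: "'a fuv" is 0 .
lift_definition one_fuv :: "'a fuv" is 1 .
lift_definition plus_fuv :: "'a fuv \<Rightarrow> 'a fuv \<Rightarrow> 'a fuv" is "(+)" by (rule uv_rel_add)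
lift_definition times_fuv :: "'a fuv \<Rightarrow> 'a fuv \<Rightarrow> 'a fuv" is "(*)" by (rule uv_rel_mult)
lift_definition uminus_fuv :: "'a fuv \<Rightarrow> 'a fuv" is uminus by (rule uv_rel_uminus)
lift_definition minus_fuv :: "'a fuv \<Rightarrow> 'a fuv \<Rightarrow> 'a fuv" is "(-)"
  by (metis uv_rel_add uv_rel_uminus diff_conv_add_uminus)

instance
proof
  fix a b c :: "'a fuv"
  show "a * b * c = a * (b * c)" by transfer (simp add: mult.assoc uv_rel_refl)
  show "a * b = b * a" by transfer (simp add: mult.commute uv_rel_refl)
  show "1 * a = a" by transfer (simp add: uv_rel_refl)
  show "a + b + c = a + (b + c)" by transfer (simp add: add.assoc uv_rel_refl)
  show "a + b = b + a" by transfer (simp add: add.commute uv_rel_refl)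
  show "0 + a = a" by transfer (simp add: uv_rel_refl)
  show "- a + a = 0" by transfer (simp add: uv_rel_refl)
  show "a - b = a + - b" by transfer (simp add: uv_rel_refl)
  show "(a + b) * c = a * c + b * c" by transfer (simp add: distrib_right uv_rel_refl)
  show "(0 :: 'a fuv) \<noteq> 1" by transfer (rule not_uv_rel_0_1)
qed

end

lift_definition emb :: "'a::field \<Rightarrow> 'a fuv" is "\<lambda>a. [:[:a:]:]" .
lift_definition u_elt :: "'a::field fuv" is u_ind .
lift_definition v_elt :: "'a::field fuv" is v_ind .

section \<open>The quotient ring \<open>R[x]/\<langle>x\<^sup>n - c\<rangle>\<close>\<close>

abbreviation Rx :: "'a::field fuv poly ring" where
  "Rx \<equiv> ring_of_type_algebra"

definition cc_ideal :: "nat \<Rightarrow> 'a::field fuv \<Rightarrow> 'a fuv poly set" where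
  "cc_ideal n c = PIdl\<^bsub>Rx\<^esub> (monom 1 n - [:c:])"

definition cc_ring :: "nat \<Rightarrow> 'a::field fuv \<Rightarrow> 'a fuv poly set ring" where
  "cc_ring n c = Rx Quot (cc_ideal n c)"

definition cls :: "nat \<Rightarrow> 'a::field fuv \<Rightarrow> 'a fuv poly \<Rightarrow> 'a fuv poly set" where
  "cls n c P = cc_ideal n c +>\<^bsub>Rx\<^esub> P"

text \<open>The ideal of \<open>R[x]/\<langle>x\<^sup>n - c\<rangle>\<close> generated by the residue classes of the polynomials in \<open>G\<close>.\<close>

definition gen :: "nat \<Rightarrow> 'a::field fuv \<Rightarrow> 'a fuv poly set \<Rightarrow> 'a fuv poly set set" where
  "gen n c G = Idl\<^bsub>cc_ring n c\<^esub> (cls n c ` G)"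

section \<open>The four types of ideals\<close>

text \<open>
  Elements of the quotient ring are given by representatives in \<open>R[x]\<close>; below \<open>a0\<close> is the
  element \<open>\<alpha>\<^sub>0\<close> of the field, and the length is \<open>n = 3p\<^sup>s\<close>.
\<close>

definition fpol :: "'a::field \<Rightarrow> 'a fuv poly" where
  "fpol a0 = monom 1 3 - [:emb a0:]"

definition quad :: "'a::field \<Rightarrow> 'a \<Rightarrow> 'a \<Rightarrow> 'a fuv poly" where
  "quad a b c = monom (emb a) 2 + monom (emb b) 1 + monom (emb c) 0"

definition upol :: "'a::field fuv poly" where
  "upol = [:u_elt:]"

definition fsum ::
  "'a::field \<Rightarrow> nat \<Rightarrow> (nat \<Rightarrow> 'a) \<Rightarrow> (nat \<Rightarrow> 'a) \<Rightarrow> (nat \<Rightarrow> 'a) \<Rightarrow> 'a fuv poly" where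
  "fsum a0 k a b c = (\<Sum>i<k. quad (a i) (b i) (c i) * fpol a0 ^ i)"

text \<open>
  The condition on \<open>z(x)\<close> in the third type, where moreover only the powers \<open>(x\<^sup>3 - \<alpha>\<^sub>0)\<^sup>i\<close>
  with \<open>i < k\<close> occur.
\<close>

definition z_cond :: "nat \<Rightarrow> 'a::field fuv \<Rightarrow> 'a \<Rightarrow> nat \<Rightarrow> 'a fuv poly \<Rightarrow> bool" where
  "z_cond n c a0 k z \<longleftrightarrow>
     z = 0 \<or>
     (cls n c z \<in> Units (cc_ring n c) \<and>
      (\<exists>z0 z1 z2. z = fsum a0 k z0 z1 z2 \<and> quad (z0 0) (z1 0) (z2 0) \<noteq> 0))"

text \<open>The smallest \<open>i\<close> with \<open>u(x\<^sup>3 - \<alpha>\<^sub>0)\<^sup>i \<in> \<langle>g\<rangle>\<close>.\<close>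

definition tors :: "nat \<Rightarrow> 'a::field fuv \<Rightarrow> 'a \<Rightarrow> 'a fuv poly \<Rightarrow> nat" where
  "tors n c a0 g = (LEAST i. cls n c (upol * fpol a0 ^ i) \<in> gen n c {g})"

definition typeA :: "nat \<Rightarrow> nat \<Rightarrow> 'a::field fuv \<Rightarrow> 'a fuv poly set set set" where
  "typeA p s c = {gen (3 * p ^ s) c {0}, gen (3 * p ^ s) c {1}}"

definition typeB :: "nat \<Rightarrow> nat \<Rightarrow> 'a::field fuv \<Rightarrow> 'a \<Rightarrow> 'a fuv poly set set set" where
  "typeB p s c a0 =
     {gen (3 * p ^ s) c {upol * fpol a0 ^ l} | l. l \<le> 2 * p ^ s - 1}"

definition typeC :: "nat \<Rightarrow> nat \<Rightarrow> 'a::field fuv \<Rightarrow> 'a \<Rightarrow> 'a fuv poly set set set" where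
  "typeC p s c a0 =
     {gen (3 * p ^ s) c {fpol a0 ^ l + upol * fpol a0 ^ t * z} | l t z.
        1 \<le> l \<and> l \<le> 2 * p ^ s - 1 \<and> t < l \<and> (\<exists>k. z_cond (3 * p ^ s) c a0 k z)}"

definition typeD :: "nat \<Rightarrow> nat \<Rightarrow> 'a::field fuv \<Rightarrow> 'a \<Rightarrow> 'a fuv poly set set set" where
  "typeD p s c a0 =
     {gen (3 * p ^ s) c
        {fpol a0 ^ l + upol * fsum a0 \<mu> a b d, upol * fpol a0 ^ \<mu>} | l \<mu> a b d.
        l \<le> 2 * p ^ s - 1 \<and>
        \<mu> < tors (3 * p ^ s) c a0 (fpol a0 ^ l + upol * fsum a0 \<mu> a b d)}"

text \<open>
  The bound \<open>i \<le> \<mu> - t - 1\<close> on the powers is \<open>i < \<mu> - t\<close>; for \<open>\<mu> \<le> t\<close> the (truncated)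
  difference is \<open>0\<close>, the sum is empty, and only \<open>z = 0\<close> remains.
\<close>

definition typeD' :: "nat \<Rightarrow> nat \<Rightarrow> 'a::field fuv \<Rightarrow> 'a \<Rightarrow> 'a fuv poly set set set" where
  "typeD' p s c a0 =
     {gen (3 * p ^ s) c
        {fpol a0 ^ l + upol * fpol a0 ^ t * z, upol * fpol a0 ^ \<mu>} | l t z \<mu>.
        l \<le> 2 * p ^ s - 1 \<and> t < l \<and> z_cond (3 * p ^ s) c a0 (\<mu> - t) z \<and>
        \<mu> < tors (3 * p ^ s) c a0 (fpol a0 ^ l + upol * fpol a0 ^ t * z)}"

end

theory Submission
  imports Defs "HOL-Number_Theory.Residues"
begin

text \<open>
  Write \<open>f = x\<^sup>3 - \<alpha>\<^sub>0\<close>, \<open>q = p^s\<close> and \<open>N = 2q\<close>. As \<open>\<alpha>\<^sub>0^q = \<alpha>\<^sub>1\<close>, the Frobenius map gives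
  \<open>f^q = x^(3q) - \<alpha>\<^sub>1\<close>, so that in the quotient ring \<open>f^q = (\<alpha>\<^sub>3 + \<alpha>\<^sub>4 u) v\<close>. The first factor is a
  unit. Hence \<open>v\<close> is a unit times \<open>f^q\<close>, and \<open>f^N = 0\<close>. Every element therefore has the form
  \<open>A + u B\<close> with polynomials \<open>A\<close>, \<open>B\<close> over the field \<open>K\<close> (lemma \<open>normal_form\<close>), and the quotient ring
  is \<open>A\<^sub>0 + u A\<^sub>0\<close> with \<open>u\<^sup>2 = 0\<close>, where \<open>A\<^sub>0 = K[x] / \<langle>f^N\<rangle>\<close>.

  The polynomial \<open>f\<close> is irreducible. A cube root of \<open>\<alpha>\<^sub>0\<close> would yield one of \<open>\<alpha>\<^sub>1\<close>, and since \<open>3\<close> is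
  invertible this would lift along the nilpotent part of \<open>\<alpha>\<close> to a cube root of \<open>\<alpha>\<close>
  (lemma \<open>cube_in_fuv\<close>). Consequently \<open>A\<^sub>0\<close> is a chain ring: each of its elements is a unit times a
  power of \<open>f\<close> (lemma \<open>incl_factor\<close>).

  An ideal \<open>I\<close> is then described by two exponents: its image modulo \<open>u\<close> is generated by \<open>f^l\<close>, and
  its elements that are multiples of \<open>u\<close> are the multiples of \<open>u f^\<mu>\<close>, where \<open>\<mu> \<le> l\<close>. So \<open>I\<close> is
  generated by some \<open>g = f^l + u h\<close> together with \<open>u f^\<mu>\<close>, where \<open>h\<close> may be truncated modulo \<open>f^\<mu>\<close>
  (lemmas \<open>ideal_structure\<close> and \<open>ideal_generators\<close>). The extreme values \<open>l = N\<close> and \<open>l = 0\<close> give the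
  trivial ideals and those generated by \<open>u f^\<mu>\<close>. Otherwise one compares \<open>\<mu>\<close> with the least
  exponent \<open>T\<close> such that \<open>u f^T\<close> lies in the ideal generated by \<open>g\<close>. If \<open>\<mu> = T\<close>, the second
  generator is redundant; if \<open>\<mu> < T\<close>, both are needed. Factoring out of \<open>h\<close> the highest power of
  \<open>f\<close> leaves zero or a unit \<open>z\<close>, which relates the two ways of writing \<open>g\<close>.

  That the ideals with \<open>\<mu> < T\<close> are not principal is the one place where elements must be shown to be
  different from zero: \<open>f^l\<close> must not become a multiple of \<open>u\<close> for \<open>l < N\<close>
  (lemma \<open>F_power_eqv_U_mult\<close>). The coefficient of \<open>uv\<close>, a linear functional on the coefficient
  ring, detects this.
\<close>

section \<open>Finite fields and irreducible cubics\<close>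

text \<open>
  Multiplication by \<open>x \<noteq> 0\<close> permutes the nonzero elements, so it leaves their product unchanged.
  Finiteness is a hypothesis here, since the type is only known to be a field.
\<close>
lemma finite_field_power_card:
  fixes x :: "'a::field"
  assumes "finite (UNIV :: 'a set)"
  shows "x ^ card (UNIV :: 'a set) = x"
proof (cases "x = 0")
  case True
  then show ?thesis using assms by (simp add: power_0_left card_eq_0_iff)
next
  case False
  let ?P = "\<Prod>y\<in>UNIV - {0}. y :: 'a"
  have "?P = (\<Prod>y\<in>UNIV - {0}. x * y)"
    by (rule prod.reindex_bij_witness[of _ "\<lambda>y. x * y" "\<lambda>y. y / x"]) (use False in auto)
  also have "\<dots> = x ^ (card (UNIV :: 'a set) - 1) * ?P"
    using assms by (simp add: prod.distrib card_Diff_singleton)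
  finally have "x ^ (card (UNIV :: 'a set) - 1) = 1"
    using assms by (simp add: prod_zero_iff)
  moreover have "card (UNIV :: 'a set) = Suc (card (UNIV :: 'a set) - 1)"
    using assms finite_UNIV_card_ge_0 by force
  ultimately show ?thesis
    by (metis power_Suc mult.right_neutral)
qed

lemma CHAR_of_card_prime_power:
  assumes "prime p" "card (UNIV :: 'a::field set) = p ^ m"
  shows "CHAR('a) = p"
proof -
  have "CHAR('a) dvd p ^ m"
    using CHAR_dvd_CARD[where 'a = 'a] assms by simp
  moreover have "CHAR('a) \<noteq> 0"
    using calculation assms(1) by (metis dvd_0_left power_not_zero not_prime_0)
  hence "prime CHAR('a)" by (simp add: prime_CHAR_semidom)
  ultimately show ?thesis
    using assms(1) by (metis prime_dvd_power primes_dvd_imp_eq)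
qed

text \<open>
  The polynomial ring is a principal ideal domain: a nonzero element of least degree in the ideal
  generated by \<open>a\<close> and \<open>f\<close> divides both, and an irreducible \<open>f\<close> not dividing \<open>a\<close> leaves it no
  choice but to be a unit.
\<close>
lemma irreducible_poly_bezout:
  fixes f a :: "'a::field poly"
  assumes "irreducible f" "\<not> f dvd a"
  shows "\<exists>x y. a * x + f * y = 1"
proof -
  define S where "S = {e. \<exists>x y. e = a * x + f * y}"
  have "f \<in> S" unfolding S_def by (auto intro: exI[of _ 0] exI[of _ 1])
  moreover have "f \<noteq> 0" using assms by auto
  ultimately obtain d where d: "d \<in> S" "d \<noteq> 0"
    and dmin: "\<And>e. e \<in> S \<Longrightarrow> e \<noteq> 0 \<Longrightarrow> degree d \<le> degree e"
    using ex_has_least_nat[of "\<lambda>e. e \<in> S \<and> e \<noteq> 0" f degree] by auto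
  have dvd: "d dvd e" if e: "e \<in> S" for e
  proof (rule ccontr)
    assume "\<not> d dvd e"
    hence nz: "e mod d \<noteq> 0" by (simp add: mod_eq_0_iff_dvd)
    obtain x y where "d = a * x + f * y" using d by (auto simp: S_def)
    moreover obtain x' y' where "e = a * x' + f * y'" using e by (auto simp: S_def)
    ultimately have "e mod d = a * (x' - (e div d) * x) + f * (y' - (e div d) * y)"
      by (subst minus_div_mult_eq_mod[symmetric]) (simp add: algebra_simps)
    hence "e mod d \<in> S" by (auto simp: S_def)
    with dmin nz have "degree d \<le> degree (e mod d)" by blast
    moreover have "degree (e mod d) < degree d" using nz d degree_mod_less' by blast
    ultimately show False by simp
  qed
  have "a \<in> S" unfolding S_def by (auto intro: exI[of _ 0] exI[of _ 1])
  hence "d dvd a" "d dvd f" using dvd \<open>f \<in> S\<close> by auto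
  then obtain k where k: "f = d * k" by (auto elim: dvdE)
  have "d dvd 1"
  proof (rule ccontr)
    assume "\<not> d dvd 1"
    hence "k dvd 1" using irreducibleD[OF assms(1) k] by blast
    hence "f dvd d" using k by (simp add: mult_unit_dvd_iff)
    thus False using \<open>d dvd a\<close> assms(2) dvd_trans by blast
  qed
  then obtain e where "1 = d * e" by (auto elim: dvdE)
  moreover obtain x y where "d = a * x + f * y" using d by (auto simp: S_def)
  ultimately have "a * (x * e) + f * (y * e) = 1" by (simp add: algebra_simps)
  thus ?thesis by blast
qed

lemma degree_cubic:
  fixes a :: "'a::field"
  shows "degree (monom 1 3 - [:a:]) = 3"
proof -
  have "monom 1 3 - [:a:] = monom 1 3 + [:- a:]"
    by (rule poly_eqI) (simp add: coeff_pCons split: nat.splits)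
  moreover have "degree (monom 1 3 + [:- a:]) = 3"
    by (subst degree_add_eq_left) (simp_all add: degree_monom_eq)
  ultimately show ?thesis by metis
qed

text \<open>
  A proper factorisation of a cubic has a linear factor, which has a root.
\<close>
lemma cubic_irreducible:
  fixes a :: "'a::field"
  assumes no_root: "\<nexists>b. b ^ 3 = a"
  shows "irreducible (monom 1 3 - [:a:])"
proof -
  let ?f = "monom 1 3 - [:a:]"
  have deg: "degree ?f = 3" by (rule degree_cubic)
  have no_linear: "degree g \<noteq> 1" if "g dvd ?f" for g
  proof
    assume "degree g = 1"
    then obtain c b where g: "g = [:c, b:]" "b \<noteq> 0"
    proof -
      obtain c g' where g': "g = pCons c g'" by (cases g)
      hence "degree g' = 0" "g' \<noteq> 0"
        using \<open>degree g = 1\<close> by (auto split: if_splits)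
      thus ?thesis using that g' by (metis degree_eq_zeroE pCons_0_0)
    qed
    define r where "r = - c / b"
    have "poly g r = 0" using g by (simp add: r_def)
    hence "poly ?f r = 0" using that by (metis dvdE poly_mult mult_zero_left)
    hence "r ^ 3 = a" by (simp add: poly_monom)
    thus False using no_root by blast
  qed
  show ?thesis
  proof (rule irreducibleI)
    show "?f \<noteq> 0" using deg by force
    show "\<not> ?f dvd 1"
      using deg by (metis is_unit_iff_degree degree_0 zero_neq_numeral)
  next
    fix g h assume gh: "?f = g * h"
    have nz: "g \<noteq> 0" "h \<noteq> 0" using gh deg by force+
    have "degree g + degree h = 3" using deg gh nz by (simp add: degree_mult_eq)
    moreover have "degree g \<noteq> 1" "degree h \<noteq> 1" using no_linear gh by (metis dvd_triv_left dvd_triv_right)+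
    ultimately have "degree g = 0 \<or> degree h = 0" by linarith
    thus "g dvd 1 \<or> h dvd 1" using nz by (simp add: is_unit_iff_degree)
  qed
qed

section \<open>Arithmetic of the coefficient ring\<close>

lemma emb_0 [simp]: "emb 0 = 0" by transfer (simp add: uv_rel_refl)
lemma emb_1 [simp]: "emb 1 = 1" by transfer (simp add: uv_rel_refl one_pCons)
lemma emb_add: "emb (a + b) = emb a + emb b" by transfer (simp add: uv_rel_refl)
lemma emb_mult: "emb (a * b) = emb a * emb b" by transfer (simp add: uv_rel_refl)
lemma emb_minus: "emb (- a) = - emb a" by transfer (simp add: uv_rel_refl)
lemma emb_power: "emb (a ^ k) = emb a ^ k" by (induction k) (simp_all add: emb_mult)

lemma u_elt_sq: "u_elt * u_elt = 0"
  by transfer (auto simp: uv_rel_def power2_eq_square intro: exI[of _ 1] exI[of _ 0])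

lemma u_elt_u_elt_mult: "u_elt * (u_elt * x) = 0"
  by (metis mult.assoc mult_zero_left u_elt_sq)

lemma v_elt_sq: "v_elt * v_elt = 0"
  by transfer (auto simp: uv_rel_def power2_eq_square intro: exI[of _ 1] exI[of _ 0])

lemma v_elt_v_elt_mult: "v_elt * (v_elt * x) = 0"
  by (metis mult.assoc mult_zero_left v_elt_sq)

lemma fuv_decomp:
  fixes w :: "'a::field fuv"
  shows "\<exists>a b c d. w = emb a + emb b * u_elt + (emb c + emb d * u_elt) * v_elt"
proof -
  have inner: "\<exists>a b. abs_fuv [:q:] = emb a + emb b * u_elt" for q :: "'a poly"
  proof (induction q)
    case 0
    have "abs_fuv [:0:] = emb 0 + emb 0 * u_elt"
      by (simp add: zero_fuv.abs_eq[symmetric])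
    thus ?case by blast
  next
    case (pCons a q)
    then obtain b c where IH: "abs_fuv [:q:] = emb b + emb c * u_elt" by blast
    have "abs_fuv [:pCons a q:] = emb a + u_elt * abs_fuv [:q:]"
      by (simp add: emb.abs_eq u_elt.abs_eq plus_fuv.abs_eq times_fuv.abs_eq)
    also have "\<dots> = emb a + emb b * u_elt"
      using IH by (simp add: algebra_simps u_elt_u_elt_mult)
    finally show ?case by blast
  qed
  have "\<exists>a b c d. abs_fuv P = emb a + emb b * u_elt + (emb c + emb d * u_elt) * v_elt"
    for P :: "'a poly poly"
  proof (induction P)
    case 0
    have "abs_fuv 0 = emb 0 + emb 0 * u_elt + (emb 0 + emb 0 * u_elt) * v_elt"
      by (simp add: zero_fuv.abs_eq[symmetric])
    thus ?case by blast
  next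
    case (pCons q P)
    then obtain a b c d
      where IH: "abs_fuv P = emb a + emb b * u_elt + (emb c + emb d * u_elt) * v_elt" by blast
    obtain a' b' where q: "abs_fuv [:q:] = emb a' + emb b' * u_elt" using inner by blast
    have "abs_fuv (pCons q P) = abs_fuv [:q:] + v_elt * abs_fuv P"
      by (simp add: v_elt.abs_eq plus_fuv.abs_eq times_fuv.abs_eq)
    also have "\<dots> = emb a' + emb b' * u_elt + (emb a + emb b * u_elt) * v_elt"
    proof -
      have "v_elt * ((emb c + emb d * u_elt) * v_elt) = 0"
        by (simp add: mult.commute[of _ v_elt] v_elt_v_elt_mult)
      thus ?thesis using IH q by (simp add: distrib_left mult.commute)
    qed
    finally show ?case by blast
  qed
  from this[of "rep_fuv w"] show ?thesis
    by (simp only: Quotient_abs_rep[OF Quotient_fuv])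
qed

text \<open>
  The coefficient of \<open>uv\<close>: a linear functional over the field that does not vanish on the socle
  \<open>\<langle>uv\<rangle>\<close> of the coefficient ring. It is the only tool used below to show that an element of the
  quotient ring is not zero.
\<close>
lift_definition uv_coeff :: "'a::field fuv \<Rightarrow> 'a" is "\<lambda>P. coeff (coeff P 1) 1"
proof -
  fix P Q :: "'a poly poly"
  assume "uv_rel P Q"
  then obtain A B where AB: "P - Q = A * u_ind ^ 2 + B * v_ind ^ 2"
    unfolding uv_rel_def by blast
  have "coeff (coeff (P - Q) 1) 1 = 0"
    unfolding AB by (simp add: power2_eq_square coeff_mult coeff_pCons split: nat.splits)
  thus "coeff (coeff P 1) 1 = coeff (coeff Q 1) 1" by simp
qed

lemma uv_coeff_0 [simp]: "uv_coeff 0 = 0" by transfer simp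
lemma uv_coeff_add: "uv_coeff (x + y) = uv_coeff x + uv_coeff y" by transfer simp
lemma uv_coeff_sum: "uv_coeff (sum g S) = (\<Sum>i\<in>S. uv_coeff (g i))"
  by (induction S rule: infinite_finite_induct) (simp_all add: uv_coeff_add)
lemma uv_coeff_emb_mult: "uv_coeff (emb a * x) = a * uv_coeff x"
  by transfer simp
lemma uv_coeff_u: "uv_coeff u_elt = 0" by transfer simp
lemma uv_coeff_uv: "uv_coeff (u_elt * v_elt) = 1"
  by transfer simp

text \<open>
  One Newton step lifts the cube root: \<open>w = \<alpha>\<^sub>3 v + \<alpha>\<^sub>4 uv\<close> satisfies \<open>w\<^sup>2 = 0\<close>, so that
  \<open>(b + k w)\<^sup>3 = b\<^sup>3 + 3 b\<^sup>2 k w\<close>, and \<open>k = 1 / (3 b\<^sup>2)\<close> makes the last term equal to \<open>w\<close>.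
\<close>
lemma cube_in_fuv:
  fixes b a3 a4 :: "'a::field"
  assumes "(3 :: 'a) \<noteq> 0" "b \<noteq> 0"
  shows "\<exists>\<beta>. \<beta> ^ 3 = emb (b ^ 3) + emb a3 * v_elt + emb a4 * u_elt * v_elt"
proof -
  define w where "w = emb a3 * v_elt + emb a4 * u_elt * v_elt"
  define k where "k = 1 / (3 * b ^ 2)"
  have ww: "w * w = 0"
  proof -
    have "w * w = (emb a3 + emb a4 * u_elt) ^ 2 * (v_elt * v_elt)"
      by (simp add: w_def power2_eq_square algebra_simps)
    thus ?thesis by (simp add: v_elt_sq)
  qed
  have "3 * k * b ^ 2 = 1" using assms by (simp add: k_def)
  hence k: "3 * emb k * emb b ^ 2 = 1"
  proof -
    assume "3 * k * b ^ 2 = 1"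
    hence "emb ((1 + 1 + 1) * k * b ^ 2) = 1" by simp
    hence "(1 + 1 + 1) * emb k * emb b ^ 2 = 1"
      by (simp only: emb_mult emb_add emb_power emb_1)
    thus ?thesis by simp
  qed
  have "(emb b + emb k * w) ^ 3
      = emb b ^ 3 + (3 * emb k * emb b ^ 2) * w
        + (3 * emb b * emb k ^ 2 + emb k ^ 3 * w) * (w * w)"
    by (simp add: power2_eq_square power3_eq_cube algebra_simps)
  also have "\<dots> = emb (b ^ 3) + w" by (simp add: k ww emb_power)
  finally show ?thesis unfolding w_def by (metis add.assoc)
qed

section \<open>Ideals of the quotient ring in terms of representatives\<close>

lemma Rx_simps:
  "carrier Rx = UNIV" "x \<otimes>\<^bsub>Rx\<^esub> y = x * y" "x \<oplus>\<^bsub>Rx\<^esub> y = x + y" "\<one>\<^bsub>Rx\<^esub> = 1" "\<zero>\<^bsub>Rx\<^esub> = 0"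
  by (simp_all add: ring_of_type_algebra_def)

lemma cring_Rx: "cring (Rx :: 'a::field fuv poly ring)"
  by (rule cring_from_type_algebra)

lemma mem_cls_iff: "x \<in> cls n c P \<longleftrightarrow> monom 1 n - [:c:] dvd x - P"
  unfolding cls_def cc_ideal_def cgenideal_def a_r_coset_def'
  by (auto simp: Rx_simps dvd_def mult.commute diff_eq_eq)

lemma cls_eq_iff: "cls n c P = cls n c Q \<longleftrightarrow> monom 1 n - [:c:] dvd P - Q"
proof
  assume "cls n c P = cls n c Q"
  moreover have "P \<in> cls n c P" by (simp add: mem_cls_iff)
  ultimately show "monom 1 n - [:c:] dvd P - Q" by (simp add: mem_cls_iff)
next
  assume *: "monom 1 n - [:c:] dvd P - Q"
  have "monom 1 n - [:c:] dvd x - P \<longleftrightarrow> monom 1 n - [:c:] dvd x - Q" for x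
    using dvd_add_left_iff[OF *, of "x - P"] by simp
  thus "cls n c P = cls n c Q" by (auto simp: mem_cls_iff)
qed

lemma ideal_cc_ideal: "ideal (cc_ideal n c) Rx"
  unfolding cc_ideal_def by (rule cring.cgenideal_ideal[OF cring_Rx]) (simp add: Rx_simps)

lemma cls_ring_hom: "cls n c \<in> ring_hom Rx (cc_ring n c)"
  using ideal.rcos_ring_hom[OF ideal_cc_ideal, of n c]
  unfolding cls_def[abs_def] cc_ring_def .

lemma cring_cc_ring: "cring (cc_ring n c)"
  unfolding cc_ring_def by (rule ideal.quotient_is_cring[OF ideal_cc_ideal cring_Rx])

lemma ring_cc_ring: "ring (cc_ring n c)"
  using cring_cc_ring by (rule cring.axioms)

lemma carrier_cc_ring: "carrier (cc_ring n c) = range (cls n c)"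
  unfolding cc_ring_def FactRing_def cls_def
  by (auto simp: A_RCOSETS_def' Rx_simps)

lemma cls_mult: "cls n c P \<otimes>\<^bsub>cc_ring n c\<^esub> cls n c Q = cls n c (P * Q)"
  using ring_hom_mult[OF cls_ring_hom, of P Q n c] by (simp add: Rx_simps)

lemma cls_add: "cls n c P \<oplus>\<^bsub>cc_ring n c\<^esub> cls n c Q = cls n c (P + Q)"
  using ring_hom_add[OF cls_ring_hom, of P Q n c] by (simp add: Rx_simps)

lemma cls_one: "\<one>\<^bsub>cc_ring n c\<^esub> = cls n c 1"
  using ring_hom_one[OF cls_ring_hom, of n c] by (simp add: Rx_simps)

lemma cls_zero: "\<zero>\<^bsub>cc_ring n c\<^esub> = cls n c 0"
  using ring_hom_zero[OF cls_ring_hom cring.axioms(1)[OF cring_Rx] ring_cc_ring, of n c]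
  by (simp add: Rx_simps)

text \<open>
  Images and preimages under the residue class map translate between the ideals of the quotient
  ring and sets of polynomials closed under addition and under multiplication by arbitrary
  polynomials. From here on an ideal \<open>I\<close> of the quotient is handled through the polynomials whose
  class lies in \<open>I\<close>, where the arithmetic of the type class of commutative rings applies.
\<close>
lemma ideal_cls_imageI:
  assumes J_zero: "0 \<in> J" and J_add: "\<And>P Q. P \<in> J \<Longrightarrow> Q \<in> J \<Longrightarrow> P + Q \<in> J"
    and J_mult: "\<And>P Q. P \<in> J \<Longrightarrow> Q * P \<in> J"
  shows "ideal (cls n c ` J) (cc_ring n c)"
proof -
  interpret cring "cc_ring n c" by (rule cring_cc_ring)
  show ?thesis
  proof (rule idealI)
    show "ring (cc_ring n c)" by (rule ring_cc_ring)
  next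
    show "subgroup (cls n c ` J) (add_monoid (cc_ring n c))"
    proof
      show "cls n c ` J \<subseteq> carrier (add_monoid (cc_ring n c))"
        by (auto simp: carrier_cc_ring)
      show "\<one>\<^bsub>add_monoid (cc_ring n c)\<^esub> \<in> cls n c ` J"
        using J_zero by (simp add: cls_zero)
      show "x \<otimes>\<^bsub>add_monoid (cc_ring n c)\<^esub> y \<in> cls n c ` J"
        if "x \<in> cls n c ` J" "y \<in> cls n c ` J" for x y
        using that J_add by (auto simp: cls_add)
      show "inv\<^bsub>add_monoid (cc_ring n c)\<^esub> x \<in> cls n c ` J" if x: "x \<in> cls n c ` J" for x
      proof -
        obtain P where P: "P \<in> J" "x = cls n c P" using x by blast
        have "\<ominus>\<^bsub>cc_ring n c\<^esub> x = cls n c (- P)"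
          by (rule minus_equality) (simp_all add: P cls_add cls_zero carrier_cc_ring)
        moreover have "- P \<in> J" using J_mult[OF P(1), of "-1"] by simp
        ultimately show ?thesis by (simp add: a_inv_def)
      qed
    qed
  next
    fix a x assume "a \<in> cls n c ` J" "x \<in> carrier (cc_ring n c)"
    thus "x \<otimes>\<^bsub>cc_ring n c\<^esub> a \<in> cls n c ` J" "a \<otimes>\<^bsub>cc_ring n c\<^esub> x \<in> cls n c ` J"
      using J_mult by (auto simp: carrier_cc_ring cls_mult mult.commute intro!: imageI)
  qed
qed

lemma gen_ideal: "ideal (gen n c G) (cc_ring n c)"
  unfolding gen_def by (rule ring.genideal_ideal[OF ring_cc_ring]) (auto simp: carrier_cc_ring)

lemma ideal_representatives:
  assumes I: "ideal I (cc_ring n c)"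
  shows "cls n c 0 \<in> I"
    and "cls n c P \<in> I \<Longrightarrow> cls n c Q \<in> I \<Longrightarrow> cls n c (P + Q) \<in> I"
    and "cls n c P \<in> I \<Longrightarrow> cls n c (Q * P) \<in> I"
    and "cls n c P \<in> I \<Longrightarrow> cls n c Q \<in> I \<Longrightarrow> cls n c (P - Q) \<in> I"
proof -
  have sub: "additive_subgroup I (cc_ring n c)" using I by (rule ideal.axioms)
  show "cls n c 0 \<in> I" using additive_subgroup.zero_closed[OF sub] by (simp add: cls_zero)
  show add: "cls n c (P + Q) \<in> I" if "cls n c P \<in> I" "cls n c Q \<in> I" for P Q
    using additive_subgroup.a_closed[OF sub that] by (simp add: cls_add)
  show mult: "cls n c (Q * P) \<in> I" if "cls n c P \<in> I" for P Q
    using ideal.I_l_closed[OF I that, of "cls n c Q"] by (simp add: cls_mult carrier_cc_ring)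
  show "cls n c (P - Q) \<in> I" if "cls n c P \<in> I" "cls n c Q \<in> I"
    using add[OF that(1) mult[OF that(2), of "- 1"]] by simp
qed

lemma gen_pair: "gen n c {g, h} = {cls n c (a * g + b * h) | a b. True}"
proof -
  let ?J = "{a * g + b * h | a b. True}"
  have "ideal (cls n c ` ?J) (cc_ring n c)"
  proof (rule ideal_cls_imageI)
    have "0 = 0 * g + 0 * h" by simp
    thus "0 \<in> ?J" by blast
    show "P + Q \<in> ?J" if PQ: "P \<in> ?J" "Q \<in> ?J" for P Q
    proof -
      obtain a b where "P = a * g + b * h" using PQ(1) by blast
      moreover obtain a' b' where "Q = a' * g + b' * h" using PQ(2) by blast
      ultimately have "P + Q = (a + a') * g + (b + b') * h" by (simp add: algebra_simps)
      thus ?thesis by blast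
    qed
    show "Q * P \<in> ?J" if P: "P \<in> ?J" for P Q
    proof -
      obtain a b where "P = a * g + b * h" using P by blast
      hence "Q * P = (Q * a) * g + (Q * b) * h" by (simp add: algebra_simps)
      thus ?thesis by blast
    qed
  qed
  moreover have "g \<in> ?J" "h \<in> ?J"
  proof -
    have "g = 1 * g + 0 * h" "h = 0 * g + 1 * h" by simp_all
    thus "g \<in> ?J" "h \<in> ?J" by blast+
  qed
  ultimately have "gen n c {g, h} \<subseteq> cls n c ` ?J"
    unfolding gen_def by (intro ring.genideal_minimal[OF ring_cc_ring]) auto
  moreover have "cls n c (a * g + b * h) \<in> gen n c {g, h}" for a b
  proof -
    have "cls n c ` {g, h} \<subseteq> gen n c {g, h}"
      unfolding gen_def by (rule ring.genideal_self[OF ring_cc_ring]) (auto simp: carrier_cc_ring)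
    hence "cls n c g \<in> gen n c {g, h}" "cls n c h \<in> gen n c {g, h}" by auto
    thus ?thesis using ideal_representatives[OF gen_ideal] by blast
  qed
  ultimately show ?thesis by blast
qed

lemma cls_mem_gen_pair:
  "cls n c P \<in> gen n c {g, h} \<longleftrightarrow> (\<exists>a b. monom 1 n - [:c:] dvd P - (a * g + b * h))"
  by (simp add: gen_pair cls_eq_iff)

lemma cls_mem_gen_single:
  "cls n c P \<in> gen n c {g} \<longleftrightarrow> (\<exists>a. monom 1 n - [:c:] dvd P - a * g)"
proof -
  have "cls n c P \<in> gen n c {g} \<longleftrightarrow> (\<exists>a b. monom 1 n - [:c:] dvd P - (a + b) * g)"
    using cls_mem_gen_pair[of n c P g g] by (simp add: distrib_right)
  also have "\<dots> \<longleftrightarrow> (\<exists>a. monom 1 n - [:c:] dvd P - a * g)"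
    by (metis add.right_neutral)
  finally show ?thesis .
qed

lemma ideal_eqI:
  assumes "ideal I (cc_ring n c)" "ideal I' (cc_ring n c)"
    and "\<And>P. cls n c P \<in> I \<longleftrightarrow> cls n c P \<in> I'"
  shows "I = I'"
proof -
  have "I \<subseteq> range (cls n c)" "I' \<subseteq> range (cls n c)"
    using ideal.Icarr[OF assms(1)] ideal.Icarr[OF assms(2)] by (auto simp: carrier_cc_ring)
  thus ?thesis using assms(3) by blast
qed

section \<open>Polynomials with coefficients in the field\<close>

definition incl :: "'a::field poly \<Rightarrow> 'a fuv poly" where
  "incl = map_poly emb"

lemma coeff_incl: "coeff (incl A) i = emb (coeff A i)"
  by (simp add: incl_def coeff_map_poly)

lemma emb_sum: "emb (sum f S) = (\<Sum>i\<in>S. emb (f i))"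
  by (induction S rule: infinite_finite_induct) (simp_all add: emb_add)

lemma incl_0 [simp]: "incl 0 = 0" by (simp add: incl_def)
lemma incl_1 [simp]: "incl 1 = 1" by (simp add: incl_def)
lemma incl_add: "incl (A + B) = incl A + incl B"
  by (rule poly_eqI) (simp add: coeff_incl emb_add)
lemma incl_minus: "incl (- A) = - incl A"
  by (rule poly_eqI) (simp add: coeff_incl emb_minus)
lemma incl_diff: "incl (A - B) = incl A - incl B"
  using incl_add[of A "- B"] by (simp add: incl_minus)
lemma incl_mult: "incl (A * B) = incl A * incl B"
  by (rule poly_eqI) (simp add: coeff_incl coeff_mult emb_sum emb_mult)
lemma incl_power: "incl (A ^ k) = incl A ^ k"
  by (induction k) (simp_all add: incl_mult)
lemma incl_pCons: "incl (pCons a A) = pCons (emb a) (incl A)"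
  by (simp add: incl_def map_poly_pCons)
lemma incl_monom: "incl (monom a k) = monom (emb a) k"
  by (simp add: incl_def map_poly_monom)

lemma incl_cubic: "incl (monom 1 3 - [:a0:]) = fpol a0"
  by (simp add: fpol_def incl_diff incl_monom incl_pCons)

lemma incl_quad: "incl [:c, b, a:] = quad a b c"
  by (rule poly_eqI)
     (simp add: coeff_incl quad_def coeff_pCons numeral_2_eq_2 split: nat.splits)

lemma quad_0 [simp]: "quad 0 0 0 = 0"
  by (simp add: quad_def)

lemma fsum_Suc:
  "fsum a0 (Suc k) a b d
    = quad (a 0) (b 0) (d 0)
      + fpol a0 * fsum a0 k (\<lambda>i. a (Suc i)) (\<lambda>i. b (Suc i)) (\<lambda>i. d (Suc i))"
  unfolding fsum_def
  by (subst sum.lessThan_Suc_shift) (simp add: sum_distrib_left mult_ac)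

lemma fsum_in_incl: "\<exists>A. fsum a0 k a b d = incl A"
proof (induction k arbitrary: a b d)
  case 0
  show ?case by (auto simp: fsum_def intro: exI[of _ 0])
next
  case (Suc k)
  obtain A where "fsum a0 k (\<lambda>i. a (Suc i)) (\<lambda>i. b (Suc i)) (\<lambda>i. d (Suc i)) = incl A"
    using Suc by blast
  hence "fsum a0 (Suc k) a b d = incl ([:d 0, b 0, a 0:] + (monom 1 3 - [:a0:]) * A)"
    by (simp only: fsum_Suc incl_add incl_mult incl_cubic incl_quad)
  thus ?case by blast
qed

text \<open>
  Repeated division with remainder by \<open>x\<^sup>3 - \<alpha>\<^sub>0\<close>: the remainders have degree at most \<open>2\<close> and are
  the digits of the expansion.
\<close>
lemma adic_expansion:
  "\<exists>a b d r. incl h = fsum a0 k a b d + fpol a0 ^ k * incl r"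
proof (induction k arbitrary: h)
  case 0
  show ?case by (auto simp: fsum_def)
next
  case (Suc k)
  let ?f = "monom 1 3 - [:a0:]"
  have "?f \<noteq> 0" using degree_cubic[of a0] by force
  hence "h mod ?f = 0 \<or> degree (h mod ?f) < 3" using degree_mod_less[of ?f h] degree_cubic[of a0] by simp
  hence "degree (h mod ?f) < 3" by auto
  hence "h mod ?f = [:coeff (h mod ?f) 0, coeff (h mod ?f) 1, coeff (h mod ?f) 2:]"
    by (intro poly_eqI) (auto simp: coeff_pCons numeral_2_eq_2 numeral_3_eq_3 coeff_eq_0 split: nat.splits)
  then obtain x y z where q: "incl (h mod ?f) = quad x y z"
    using incl_quad by metis
  obtain a b d r where IH: "incl (h div ?f) = fsum a0 k a b d + fpol a0 ^ k * incl r"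
    using Suc by blast
  have "incl h = incl (h mod ?f + ?f * (h div ?f))" by simp
  also have "\<dots> = quad x y z + fpol a0 * (fsum a0 k a b d + fpol a0 ^ k * incl r)"
    by (simp only: incl_add incl_mult incl_cubic q IH)
  also have "\<dots> = fsum a0 (Suc k) (case_nat x a) (case_nat y b) (case_nat z d)
      + fpol a0 ^ Suc k * incl r"
    by (simp add: fsum_Suc algebra_simps)
  finally show ?case by blast
qed

text \<open>
  The exponent \<open>t\<close> is the position of the first nonzero digit. Splitting off this power of
  \<open>x\<^sup>3 - \<alpha>\<^sub>0\<close> leaves an expansion whose digit of index \<open>0\<close> does not vanish.
\<close>
lemma fsum_factor:
  "fsum a0 k a b d = 0 \<or>
    (\<exists>t<k. quad (a t) (b t) (d t) \<noteq> 0 \<and>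
      fsum a0 k a b d = fpol a0 ^ t * fsum a0 (k - t) (\<lambda>i. a (i + t)) (\<lambda>i. b (i + t)) (\<lambda>i. d (i + t)))"
proof (induction k arbitrary: a b d)
  case 0
  show ?case by (simp add: fsum_def)
next
  case (Suc k)
  show ?case
  proof (cases "quad (a 0) (b 0) (d 0) = 0")
    case False
    thus ?thesis by (intro disjI2 exI[of _ 0]) simp
  next
    case True
    let ?a = "\<lambda>i. a (Suc i)" and ?b = "\<lambda>i. b (Suc i)" and ?d = "\<lambda>i. d (Suc i)"
    have eq: "fsum a0 (Suc k) a b d = fpol a0 * fsum a0 k ?a ?b ?d"
      using True by (simp add: fsum_Suc)
    consider "fsum a0 k ?a ?b ?d = 0"
      | t where "t < k" "quad (?a t) (?b t) (?d t) \<noteq> 0"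
          "fsum a0 k ?a ?b ?d
            = fpol a0 ^ t * fsum a0 (k - t) (\<lambda>i. ?a (i + t)) (\<lambda>i. ?b (i + t)) (\<lambda>i. ?d (i + t))"
      using Suc[of ?a ?b ?d] by blast
    thus ?thesis
    proof cases
      case 1
      thus ?thesis using eq by simp
    next
      case 2
      thus ?thesis by (intro disjI2 exI[of _ "Suc t"]) (simp add: eq mult.assoc)
    qed
  qed
qed

text \<open>
  Conversely, multiplication by a power of \<open>x\<^sup>3 - \<alpha>\<^sub>0\<close> inserts zero digits in front.
\<close>
lemma fsum_shift: "\<exists>a b d. fpol a0 ^ t * fsum a0 k z0 z1 z2 = fsum a0 (t + k) a b d"
proof (induction t)
  case 0
  show ?case by auto
next
  case (Suc t)
  then obtain a b d where "fpol a0 ^ t * fsum a0 k z0 z1 z2 = fsum a0 (t + k) a b d" by blast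
  hence "fpol a0 ^ Suc t * fsum a0 k z0 z1 z2
      = fsum a0 (Suc t + k) (case_nat 0 a) (case_nat 0 b) (case_nat 0 d)"
    by (simp add: fsum_Suc mult.assoc)
  thus ?case by blast
qed

text \<open>
  A nonzero polynomial of degree at most \<open>2\<close> is not divisible by the cubic, and the later terms of
  the expansion do not affect divisibility. This is the source of the units among the expansions.
\<close>
lemma fsum_eq_cubic_dvd:
  assumes "k > 0" "quad (a 0) (b 0) (d 0) \<noteq> 0"
  shows "\<exists>A. fsum a0 k a b d = incl A \<and> \<not> (monom 1 3 - [:a0:]) dvd A"
proof -
  let ?f = "monom 1 3 - [:a0:]" and ?q = "[:d 0, b 0, a 0:]"
  obtain k' where k': "k = Suc k'" using assms by (cases k) auto
  obtain A where A: "fsum a0 k' (\<lambda>i. a (Suc i)) (\<lambda>i. b (Suc i)) (\<lambda>i. d (Suc i)) = incl A"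
    using fsum_in_incl by blast
  have "fsum a0 k a b d = incl (?q + ?f * A)"
    by (simp only: k' A fsum_Suc incl_add incl_mult incl_cubic incl_quad)
  moreover have "\<not> ?f dvd ?q + ?f * A"
  proof
    assume "?f dvd ?q + ?f * A"
    hence dvd: "?f dvd ?q" by (simp add: dvd_add_left_iff)
    have "?q \<noteq> 0" using assms(2) by auto
    hence "3 \<le> degree ?q" using dvd_imp_degree_le[OF dvd] by (simp add: degree_cubic)
    thus False by (simp split: if_splits)
  qed
  ultimately show ?thesis by blast
qed

section \<open>The quotient ring as a chain ring extended by \<open>u\<close>\<close>

text \<open>
  What governs the structure of the quotient: \<open>x\<^sup>3 - \<alpha>\<^sub>0\<close> is irreducible, its power with
  exponent \<open>p^s\<close> is \<open>x^(3p^s) - \<alpha>\<^sub>1\<close>, and \<open>\<alpha>\<^sub>3 + \<alpha>\<^sub>4 u\<close> is a unit.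
\<close>
locale cubic_constacyclic =
  fixes p s :: nat and a0 a1 a3 a4 :: "'a::field"
  assumes prime_p: "prime p" and char_p: "CHAR('a) = p"
    and a0_power: "a0 ^ (p ^ s) = a1"
    and a0_not_cube: "\<nexists>b. b ^ 3 = a0"
    and a3_nonzero: "a3 \<noteq> 0"
begin

abbreviation f :: "'a poly" where "f \<equiv> monom 1 3 - [:a0:]"
abbreviation F :: "'a fuv poly" where "F \<equiv> fpol a0"
abbreviation U :: "'a fuv poly" where "U \<equiv> upol"
abbreviation n :: nat where "n \<equiv> 3 * p ^ s"
abbreviation N :: nat where "N \<equiv> 2 * p ^ s"
definition c :: "'a fuv" where "c = emb a1 + emb a3 * v_elt + emb a4 * u_elt * v_elt"
definition W :: "'a fuv poly" where "W = [:(emb a3 + emb a4 * u_elt) * v_elt:]"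

definition eqv :: "'a fuv poly \<Rightarrow> 'a fuv poly \<Rightarrow> bool" (infix \<open>\<asymp>\<close> 50) where
  "P \<asymp> Q \<longleftrightarrow> monom 1 n - [:c:] dvd P - Q"

lemma eqv_cls: "P \<asymp> Q \<longleftrightarrow> cls n c P = cls n c Q"
  by (simp add: eqv_def cls_eq_iff)

lemma eqv_refl [simp]: "P \<asymp> P" by (simp add: eqv_cls)
lemma eqv_sym: "P \<asymp> Q \<Longrightarrow> Q \<asymp> P" by (simp add: eqv_cls)
lemma eqv_trans [trans]: "P \<asymp> Q \<Longrightarrow> Q \<asymp> S \<Longrightarrow> P \<asymp> S" by (simp add: eqv_cls)

lemma eqv_add: "P \<asymp> Q \<Longrightarrow> P' \<asymp> Q' \<Longrightarrow> P + P' \<asymp> Q + Q'"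
  unfolding eqv_cls by (metis cls_add)

lemma eqv_mult: "P \<asymp> Q \<Longrightarrow> P' \<asymp> Q' \<Longrightarrow> P * P' \<asymp> Q * Q'"
  unfolding eqv_cls by (metis cls_mult)

lemma eqv_mult_left: "P \<asymp> Q \<Longrightarrow> R * P \<asymp> R * Q"
  by (rule eqv_mult) auto

lemma eqv_mult_right: "P \<asymp> Q \<Longrightarrow> P * R \<asymp> Q * R"
  by (rule eqv_mult) auto

lemma eqv_diff_0: "P - Q \<asymp> 0 \<longleftrightarrow> P \<asymp> Q"
  by (simp add: eqv_def)

lemma N_pos: "0 < N"
  using prime_p by (simp add: prime_gt_0_nat)

text \<open>
  The Frobenius map is additive. It is applied to \<open>x\<^sup>3 = (x\<^sup>3 - \<alpha>\<^sub>0) + \<alpha>\<^sub>0\<close> rather than to the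
  difference, which avoids a distinction between \<open>p = 2\<close> and odd \<open>p\<close>.
\<close>
lemma cubic_power: "f ^ (p ^ s) = monom 1 n - [:a1:]"
proof -
  have char: "prime CHAR('a poly)" "p ^ s = CHAR('a poly) ^ s"
    using prime_p char_p by simp_all
  have "monom 1 n = (f + [:a0:]) ^ (p ^ s)"
    by (simp add: monom_power)
  also have "\<dots> = f ^ (p ^ s) + [:a0:] ^ (p ^ s)"
    by (rule freshmans_dream'[OF char])
  also have "[:a0:] ^ (p ^ s) = [:a1:]"
    by (simp add: poly_const_pow a0_power)
  finally show ?thesis by (simp add: algebra_simps)
qed

lemma F_power: "F ^ (p ^ s) = monom 1 n - [:emb a1:]"
proof -
  have "F ^ (p ^ s) = incl (f ^ (p ^ s))" by (simp only: incl_power incl_cubic)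
  thus ?thesis by (simp add: cubic_power incl_diff incl_monom incl_pCons)
qed

lemma modulus_eq: "monom 1 n - [:c:] = F ^ (p ^ s) - W"
  by (simp add: F_power c_def W_def algebra_simps)

lemma W_sq: "W * W = 0"
proof -
  have "W * W = [:(emb a3 + emb a4 * u_elt) ^ 2 * (v_elt * v_elt):]"
    by (simp add: W_def power2_eq_square mult_ac)
  thus ?thesis by (simp add: v_elt_sq)
qed

lemma modulus_mult: "(monom 1 n - [:c:]) * (F ^ (p ^ s) + W) = F ^ N"
proof -
  have "(F ^ (p ^ s) - W) * (F ^ (p ^ s) + W) = F ^ (p ^ s) * F ^ (p ^ s) - W * W"
    by (simp add: algebra_simps)
  thus ?thesis by (simp add: modulus_eq W_sq mult_2 power_add)
qed

text \<open>
  Modulo \<open>x^n - c\<close> the element \<open>F^(p^s)\<close> is \<open>v\<close> times a unit. This is why \<open>v\<close> disappears from the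
  description of the ideals, and why the nilpotency index of \<open>F\<close> doubles to \<open>N = 2p^s\<close>.
\<close>
lemma F_power_W: "F ^ (p ^ s) \<asymp> W"
  by (simp add: eqv_def modulus_eq)

lemma F_power_N: "F ^ N \<asymp> 0"
  by (simp add: eqv_def flip: modulus_mult)

lemma U_sq: "U * U = 0"
  by (simp add: upol_def u_elt_sq)

lemma U_U_mult: "U * (U * P) = 0"
  by (metis mult.assoc mult_zero_left U_sq)

subsection \<open>Normal form of the elements\<close>

definition has_normal_form :: "'a fuv poly \<Rightarrow> bool" where
  "has_normal_form P \<longleftrightarrow> (\<exists>A B. P \<asymp> incl A + U * incl B)"

lemma has_normal_form_incl: "has_normal_form (incl A)"
proof -
  have "incl A \<asymp> incl A + U * incl 0" by simp
  thus ?thesis unfolding has_normal_form_def by blast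
qed

lemma has_normal_form_U: "has_normal_form U"
proof -
  have "U \<asymp> incl 0 + U * incl 1" by simp
  thus ?thesis unfolding has_normal_form_def by blast
qed

lemma has_normal_form_add:
  assumes "has_normal_form P" "has_normal_form Q"
  shows "has_normal_form (P + Q)"
proof -
  obtain A B A' B' where "P \<asymp> incl A + U * incl B" "Q \<asymp> incl A' + U * incl B'"
    using assms unfolding has_normal_form_def by blast
  hence "P + Q \<asymp> (incl A + U * incl B) + (incl A' + U * incl B')" by (rule eqv_add)
  also have "\<dots> = incl (A + A') + U * incl (B + B')" by (simp add: incl_add algebra_simps)
  finally show ?thesis unfolding has_normal_form_def by blast
qed

lemma has_normal_form_mult:
  assumes "has_normal_form P" "has_normal_form Q"
  shows "has_normal_form (P * Q)"
proof -
  obtain A B A' B' where "P \<asymp> incl A + U * incl B" "Q \<asymp> incl A' + U * incl B'"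
    using assms unfolding has_normal_form_def by blast
  hence "P * Q \<asymp> (incl A + U * incl B) * (incl A' + U * incl B')" by (rule eqv_mult)
  also have "\<dots> = incl A * incl A' + U * (incl A * incl B' + B'' * incl A') + U * U * (B'' * incl B')"
    if "B'' = incl B" for B'' by (simp add: that algebra_simps)
  hence "(incl A + U * incl B) * (incl A' + U * incl B') = incl (A * A') + U * incl (A * B' + B * A')"
    by (simp add: U_sq incl_mult incl_add)
  finally show ?thesis unfolding has_normal_form_def by blast
qed

lemma has_normal_form_eqv: "has_normal_form Q \<Longrightarrow> P \<asymp> Q \<Longrightarrow> has_normal_form P"
  unfolding has_normal_form_def using eqv_trans by blast

lemma has_normal_form_const: "has_normal_form [:emb a:]"
  using has_normal_form_incl[of "[:a:]"] by (simp add: incl_pCons)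

text \<open>
  The factor \<open>1 / \<alpha>\<^sub>3 - (\<alpha>\<^sub>4 / \<alpha>\<^sub>3\<^sup>2) u\<close> is the inverse of \<open>\<alpha>\<^sub>3 + \<alpha>\<^sub>4 u\<close>, hence it turns
  \<open>W = (\<alpha>\<^sub>3 + \<alpha>\<^sub>4 u) v\<close>, and with it \<open>F^(p^s)\<close>, into \<open>v\<close>.
\<close>
lemma has_normal_form_v: "has_normal_form [:v_elt:]"
proof -
  let ?k = "emb (1 / a3) + emb (- a4 / a3 ^ 2) * u_elt"
  have "emb (1 / a3) * emb a3 = 1"
    "emb (1 / a3) * emb a4 + emb (- a4 / a3 ^ 2) * emb a3 = 0"
    using a3_nonzero by (simp_all flip: emb_mult emb_add add: power2_eq_square)
  moreover have "?k * (emb a3 + emb a4 * u_elt)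
      = emb (1 / a3) * emb a3 + (emb (1 / a3) * emb a4 + emb (- a4 / a3 ^ 2) * emb a3) * u_elt
        + emb (- a4 / a3 ^ 2) * emb a4 * (u_elt * u_elt)"
    by (simp only: distrib_left distrib_right mult_ac add_ac)
  ultimately have "?k * (emb a3 + emb a4 * u_elt) = 1"
    by (simp only: u_elt_sq mult_zero_left mult_zero_right add_0_right)
  hence "?k * ((emb a3 + emb a4 * u_elt) * v_elt) = v_elt"
    by (simp only: mult.assoc[symmetric] mult_1)
  hence "[:v_elt:] = [:?k:] * W"
    by (simp add: W_def mult_ac)
  hence "[:v_elt:] \<asymp> [:?k:] * F ^ (p ^ s)"
    by (simp only: eqv_mult_left[OF eqv_sym[OF F_power_W]])
  also have "\<dots> = ([:emb (1 / a3):] + [:emb (- a4 / a3 ^ 2):] * U) * incl (f ^ (p ^ s))"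
    by (simp add: upol_def incl_power incl_cubic mult_ac)
  finally have "[:v_elt:] \<asymp> ([:emb (1 / a3):] + [:emb (- a4 / a3 ^ 2):] * U) * incl (f ^ (p ^ s))" .
  thus ?thesis
    by (rule has_normal_form_eqv[rotated])
       (intro has_normal_form_add has_normal_form_mult has_normal_form_const has_normal_form_U has_normal_form_incl)
qed

lemma normal_form: "\<exists>A B. P \<asymp> incl A + U * incl B"
proof -
  have const: "has_normal_form [:w:]" for w
  proof -
    obtain a b d e where "w = emb a + emb b * u_elt + (emb d + emb e * u_elt) * v_elt"
      using fuv_decomp by blast
    hence "[:w:] = [:emb a:] + [:emb b:] * U + ([:emb d:] + [:emb e:] * U) * [:v_elt:]"
      by (simp add: upol_def mult_ac)
    thus ?thesis
      by (simp only: has_normal_form_add has_normal_form_mult has_normal_form_const has_normal_form_U has_normal_form_v)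
  qed
  have "has_normal_form P"
  proof (induction P)
    case 0
    show ?case using has_normal_form_incl[of 0] by simp
  next
    case (pCons w P)
    have "pCons w P = [:w:] + incl [:0, 1:] * P" by (simp add: incl_pCons)
    thus ?case
      by (simp only: has_normal_form_add has_normal_form_mult const has_normal_form_incl pCons)
  qed
  thus ?thesis by (simp add: has_normal_form_def)
qed

subsection \<open>Units\<close>

definition invertible :: "'a fuv poly \<Rightarrow> bool" where
  "invertible P \<longleftrightarrow> (\<exists>Q. P * Q \<asymp> 1)"

lemma invertible_Units: "invertible P \<Longrightarrow> cls n c P \<in> Units (cc_ring n c)"
  unfolding invertible_def Units_def
  by (auto simp: carrier_cc_ring cls_one cls_mult eqv_cls mult.commute intro!: bexI)

text \<open>
  The geometric series terminates because \<open>F\<close> is nilpotent.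
\<close>
lemma invertible_one_minus: "invertible (1 - F * Y)"
proof -
  have "(1 - F * Y) * (\<Sum>i<N. (F * Y) ^ i) = 1 - F ^ N * Y ^ N"
    by (simp add: one_diff_power_eq flip: power_mult_distrib)
  moreover have "1 - F ^ N * Y ^ N \<asymp> 1"
    using eqv_mult_right[OF F_power_N, of "Y ^ N"] by (simp add: eqv_def)
  ultimately show ?thesis unfolding invertible_def by metis
qed

lemma invertible_if_mult: "invertible (P * Q) \<Longrightarrow> invertible P"
  unfolding invertible_def by (auto simp: mult.assoc)

lemma invertible_mult: "invertible P \<Longrightarrow> invertible Q \<Longrightarrow> invertible (P * Q)"
proof -
  assume "invertible P" "invertible Q"
  then obtain P' Q' where "P * P' \<asymp> 1" "Q * Q' \<asymp> 1" unfolding invertible_def by blast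
  hence "(P * P') * (Q * Q') \<asymp> 1 * 1" by (rule eqv_mult)
  moreover have "(P * P') * (Q * Q') = (P * Q) * (P' * Q')" by (simp add: mult_ac)
  ultimately show ?thesis unfolding invertible_def by auto
qed

text \<open>
  A Bezout identity \<open>A x + f y = 1\<close> makes \<open>A\<close> invertible up to a nilpotent error.
\<close>
lemma invertible_incl:
  assumes "\<not> f dvd A"
  shows "invertible (incl A)"
proof -
  obtain x y where "A * x + f * y = 1"
    using irreducible_poly_bezout[OF cubic_irreducible[OF a0_not_cube] assms] by blast
  hence "incl (A * x) + incl (f * y) = 1" by (metis incl_add incl_1)
  hence "incl A * incl x = 1 - F * incl y"
    by (simp only: incl_mult incl_cubic eq_diff_eq)
  thus ?thesis using invertible_one_minus invertible_if_mult by metis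
qed

text \<open>
  Multiplying by the conjugate \<open>A - u B\<close> removes the part divisible by \<open>u\<close>, as \<open>u\<^sup>2 = 0\<close>.
\<close>
lemma invertible_normal_form:
  assumes "\<not> f dvd A"
  shows "invertible (incl A + U * B)"
proof -
  have "(incl A + U * B) * (incl A - U * B) = incl A * incl A - U * U * (B * B)"
    by (simp add: algebra_simps)
  hence "(incl A + U * B) * (incl A - U * B) = incl A * incl A" by (simp add: U_sq)
  thus ?thesis
    using invertible_mult invertible_incl[OF assms] invertible_if_mult by metis
qed

text \<open>
  Together with the units found above, this says that the polynomials over the field form a chain
  ring modulo \<open>F^N\<close>: every element is a unit times a power of \<open>F\<close>. Zero is covered by \<open>k = N\<close>, so
  that later arguments need no case distinction.
\<close>
lemma incl_factor: "\<exists>k a. k \<le> N \<and> \<not> f dvd a \<and> incl A \<asymp> F ^ k * incl a"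
proof -
  have f_nonunit: "\<not> f dvd 1"
    using cubic_irreducible[OF a0_not_cube] by (simp add: irreducible_def)
  have zero: "\<exists>k a. k \<le> N \<and> \<not> f dvd a \<and> P \<asymp> F ^ k * incl a" if "P \<asymp> 0" for P
    using f_nonunit eqv_trans[OF that eqv_sym[OF F_power_N]]
    by (intro exI[of _ N] exI[of _ 1]) simp
  show ?thesis
  proof (cases "A = 0")
    case True
    thus ?thesis using zero[of "incl A"] by simp
  next
    case False
    have "\<exists>k a. \<not> f dvd a \<and> A = f ^ k * a" using False
    proof (induction "degree A" arbitrary: A rule: less_induct)
      case less
      show ?case
      proof (cases "f dvd A")
        case False
        thus ?thesis by (intro exI[of _ 0] exI[of _ A]) simp
      next
        case True
        then obtain A' where A': "A = f * A'" by (auto elim: dvdE)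
        with less.prems have nz: "f \<noteq> 0" "A' \<noteq> 0" by auto
        hence "degree A = 3 + degree A'" using A' by (simp add: degree_mult_eq degree_cubic)
        then obtain k a where "\<not> f dvd a" "A' = f ^ k * a"
          using less.hyps[of A'] nz by auto
        hence "\<not> f dvd a \<and> A = f ^ Suc k * a" using A' by (simp add: mult.assoc)
        thus ?thesis by blast
      qed
    qed
    then obtain k a where ka: "\<not> f dvd a" "A = f ^ k * a" by blast
    have eq: "incl A = F ^ k * incl a"
      by (simp only: ka incl_mult incl_power incl_cubic)
    show ?thesis
    proof (cases "k \<le> N")
      case True
      thus ?thesis using ka(1) eq eqv_refl by metis
    next
      case False
      hence "F ^ k = F ^ N * F ^ (k - N)" by (simp flip: power_add)
      hence "incl A = F ^ N * (F ^ (k - N) * incl a)" using eq by (simp add: mult.assoc)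
      hence "incl A \<asymp> 0" using eqv_mult_right[OF F_power_N] by simp
      thus ?thesis by (rule zero)
    qed
  qed
qed

subsection \<open>Nilpotency index of \<open>x\<^sup>3 - \<alpha>\<^sub>0\<close> modulo \<open>u\<close>\<close>

lemma map_uv_coeff_incl_mult: "map_poly uv_coeff (incl A * P) = A * map_poly uv_coeff P"
  by (rule poly_eqI)
     (simp add: coeff_map_poly coeff_mult coeff_incl uv_coeff_sum uv_coeff_emb_mult)

lemma map_uv_coeff_add: "map_poly uv_coeff (P + Q) = map_poly uv_coeff P + map_poly uv_coeff Q"
  by (rule poly_eqI) (simp add: coeff_map_poly uv_coeff_add)

text \<open>
  Multiplying an equation \<open>F^l = u Z + (x^n - c) Q\<close> by \<open>u (F^(p^s) + W)\<close> kills the term in \<open>Z\<close> and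
  turns the modulus into \<open>F^N\<close>, since \<open>x^n - c = F^(p^s) - W\<close> and \<open>W\<^sup>2 = 0\<close>. On the left, \<open>u W\<close>
  equals \<open>\<alpha>\<^sub>3 uv\<close>. Comparing the coefficients of \<open>uv\<close> gives an equation
  \<open>\<alpha>\<^sub>3 f^l = f^N Q'\<close> over the field, whence \<open>N \<le> l\<close> by comparing degrees.
\<close>
lemma F_power_eqv_U_mult:
  assumes "F ^ l \<asymp> U * Z"
  shows "N \<le> l"
proof -
  let ?c = "map_poly uv_coeff"
  obtain Q where Q: "F ^ l - U * Z = (monom 1 n - [:c:]) * Q"
    using assms by (auto simp: eqv_def elim: dvdE)
  have F_incl: "F ^ k = incl (f ^ k)" for k by (simp add: incl_power incl_cubic)
  have U_W: "U * W = [:emb a3 * (u_elt * v_elt):]"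
    by (simp add: upol_def W_def algebra_simps u_elt_u_elt_mult)
  have "F ^ N * (U * Q) = U * (F ^ (p ^ s) + W) * ((monom 1 n - [:c:]) * Q)"
    by (simp add: mult_ac flip: modulus_mult)
  also have "\<dots> = U * (F ^ (p ^ s) + W) * (F ^ l - U * Z)"
    by (simp only: Q)
  also have "\<dots> = U * (F ^ (p ^ s) + W) * F ^ l - U * U * ((F ^ (p ^ s) + W) * Z)"
    by (simp only: left_diff_distrib right_diff_distrib mult_ac)
  also have "\<dots> = F ^ (l + p ^ s) * U + F ^ l * (U * W)"
    by (simp add: U_sq power_add algebra_simps)
  finally have "incl (f ^ N) * (U * Q) = incl (f ^ (l + p ^ s)) * U + incl (f ^ l) * (U * W)"
    by (simp only: F_incl)
  hence "?c (incl (f ^ N) * (U * Q)) = ?c (incl (f ^ (l + p ^ s)) * U + incl (f ^ l) * (U * W))"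
    by (rule arg_cong)
  hence "f ^ N * ?c (U * Q) = f ^ (l + p ^ s) * ?c U + f ^ l * ?c (U * W)"
    by (simp only: map_uv_coeff_add map_uv_coeff_incl_mult)
  moreover have "?c U = 0"
    by (simp add: upol_def map_poly_pCons uv_coeff_u)
  moreover have "?c (U * W) = [:a3:]"
    by (simp add: U_W map_poly_pCons uv_coeff_emb_mult uv_coeff_uv)
  ultimately have "f ^ N * ?c (U * Q) = smult a3 (f ^ l)" by simp
  hence "f ^ N dvd smult a3 (f ^ l)" by (metis dvd_triv_left)
  hence dvd: "f ^ N dvd f ^ l" using a3_nonzero by (simp add: dvd_smult_iff)
  have "f \<noteq> 0" using degree_cubic[of a0] by force
  hence "3 * N \<le> 3 * l"
    using dvd_imp_degree_le[OF dvd] by (simp add: degree_power_eq degree_cubic)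
  thus ?thesis by simp
qed

subsection \<open>Ideals\<close>

lemma mem_gen_pair: "cls n c P \<in> gen n c {g, h} \<longleftrightarrow> (\<exists>a b. P \<asymp> a * g + b * h)"
  by (simp add: cls_mem_gen_pair eqv_def)

lemma mem_gen_single: "cls n c P \<in> gen n c {g} \<longleftrightarrow> (\<exists>a. P \<asymp> a * g)"
  by (simp add: cls_mem_gen_single eqv_def)

lemma gen_mem: "cls n c g \<in> gen n c {g, h}" "cls n c h \<in> gen n c {g, h}" "cls n c g \<in> gen n c {g}"
proof -
  have "g \<asymp> 1 * g + 0 * h" "h \<asymp> 0 * g + 1 * h" "g \<asymp> 1 * g" by simp_all
  thus "cls n c g \<in> gen n c {g, h}" "cls n c h \<in> gen n c {g, h}" "cls n c g \<in> gen n c {g}"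
    unfolding mem_gen_pair mem_gen_single by blast+
qed

lemma ideal_eq_gen_pair:
  assumes I: "ideal I (cc_ring n c)" and "cls n c g \<in> I" "cls n c h \<in> I"
    and "\<And>P. cls n c P \<in> I \<Longrightarrow> \<exists>a b. P \<asymp> a * g + b * h"
  shows "I = gen n c {g, h}"
proof (rule ideal_eqI[OF I gen_ideal])
  show "cls n c P \<in> I \<longleftrightarrow> cls n c P \<in> gen n c {g, h}" for P
  proof
    assume "cls n c P \<in> gen n c {g, h}"
    then obtain a b where "P \<asymp> a * g + b * h" by (auto simp: mem_gen_pair)
    thus "cls n c P \<in> I" using assms ideal_representatives[OF I] by (simp add: eqv_cls)
  qed (use assms in \<open>simp add: mem_gen_pair\<close>)
qed

lemma gen_pair_absorb:
  assumes "cls n c h \<in> gen n c {g}"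
  shows "gen n c {g, h} = gen n c {g}"
proof (rule ideal_eq_gen_pair[symmetric])
  show "\<exists>a b. P \<asymp> a * g + b * h" if P: "cls n c P \<in> gen n c {g}" for P
  proof -
    obtain a where "P \<asymp> a * g + 0 * h" using P by (auto simp: mem_gen_single)
    thus ?thesis by blast
  qed
qed (use assms gen_ideal gen_mem in auto)

lemma gen_single_subset:
  assumes "cls n c g \<in> gen n c {h}"
  shows "gen n c {g} \<subseteq> gen n c {h}"
  unfolding gen_def
  by (rule ring.genideal_minimal[OF ring_cc_ring])
     (use assms gen_ideal[of n c "{h}"] in \<open>auto simp: gen_def\<close>)

lemma tors_mem: "cls n c (U * F ^ tors n c a0 (F ^ l + U * h)) \<in> gen n c {F ^ l + U * h}"
  and tors_le: "tors n c a0 (F ^ l + U * h) \<le> l"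
proof -
  have "U * (F ^ l + U * h) = U * F ^ l" by (simp add: distrib_left U_U_mult)
  hence "cls n c (U * F ^ l) \<in> gen n c {F ^ l + U * h}"
    unfolding mem_gen_single by (metis eqv_refl)
  thus "cls n c (U * F ^ tors n c a0 (F ^ l + U * h)) \<in> gen n c {F ^ l + U * h}"
    "tors n c a0 (F ^ l + U * h) \<le> l"
    unfolding tors_def by (fact LeastI, fact Least_le)
qed

subsection \<open>Generators of an arbitrary ideal\<close>

lemma U_mult_normal_form: "\<exists>C. U * P \<asymp> U * incl C"
proof -
  obtain A B where "P \<asymp> incl A + U * incl B" using normal_form by blast
  hence "U * P \<asymp> U * (incl A + U * incl B)" by (rule eqv_mult_left)
  thus ?thesis by (auto simp: distrib_left U_U_mult)
qed

text \<open>
  The classical description of an ideal of \<open>A + u A\<close> over a chain ring \<open>A\<close>: its image modulo \<open>u\<close>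
  is generated by a power \<open>F^l\<close>, and the multiples of \<open>u\<close> in it by some \<open>u F^\<mu>\<close>. Both exponents
  are chosen minimal; since every element of \<open>A\<close> is a unit times a power of \<open>F\<close>, minimality of the
  exponent amounts to divisibility. An element of the ideal is then first reduced modulo \<open>u\<close> by a
  lift of \<open>F^l\<close>, and what remains is a multiple of \<open>u\<close>, hence of \<open>u F^\<mu>\<close>.
\<close>
lemma ideal_structure:
  assumes I: "ideal I (cc_ring n c)"
  obtains l \<mu> h where "l \<le> N" "\<mu> \<le> l"
    "cls n c (F ^ l + U * incl h) \<in> I" "cls n c (U * F ^ \<mu>) \<in> I"
    "\<And>i. cls n c (U * F ^ i) \<in> I \<Longrightarrow> \<mu> \<le> i"
    "\<And>P. cls n c (U * P) \<in> I \<Longrightarrow> \<exists>b. U * P \<asymp> b * (U * F ^ \<mu>)"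
    "\<And>P. cls n c P \<in> I \<Longrightarrow> \<exists>a b. P \<asymp> a * (F ^ l + U * incl h) + b * (U * F ^ \<mu>)"
proof -
  note I_rules = ideal_representatives[OF I]
  have transport: "cls n c Q \<in> I" if "P \<asymp> Q" "cls n c P \<in> I" for P Q
    using that by (simp add: eqv_cls)
  define is_order where "is_order k \<longleftrightarrow> (\<exists>B. cls n c (F ^ k + U * incl B) \<in> I)" for k
  define l where "l = (LEAST k. is_order k)"
  define \<mu> where "\<mu> = (LEAST i. cls n c (U * F ^ i) \<in> I)"
  have "F ^ N + U * incl 0 \<asymp> 0" using F_power_N by simp
  hence N: "is_order N" unfolding is_order_def using transport I_rules(1) eqv_sym by blast
  have l_le: "l \<le> N" and l_min: "\<And>k. is_order k \<Longrightarrow> l \<le> k"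
    unfolding l_def using N by (auto intro: Least_le)
  have "is_order l" unfolding l_def using N by (rule LeastI)
  then obtain h where h: "cls n c (F ^ l + U * incl h) \<in> I" unfolding is_order_def by blast
  have "cls n c (U * (F ^ l + U * incl h)) \<in> I" using h I_rules by blast
  hence U_l: "cls n c (U * F ^ l) \<in> I" by (simp add: distrib_left U_U_mult)
  have \<mu>_mem: "cls n c (U * F ^ \<mu>) \<in> I" unfolding \<mu>_def using U_l by (rule LeastI)
  have \<mu>_min: "\<mu> \<le> i" if "cls n c (U * F ^ i) \<in> I" for i
    unfolding \<mu>_def using that by (rule Least_le)
  \<comment> \<open>Write the cofactor of \<open>u\<close> as \<open>F^k\<close> times a unit and divide by that unit: then \<open>u F^k\<close> lies in \<open>I\<close>.\<close>
  have torsion: "\<exists>b. U * P \<asymp> b * (U * F ^ \<mu>)" if P: "cls n c (U * P) \<in> I" for P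
  proof -
    obtain C where C: "U * P \<asymp> U * incl C" using U_mult_normal_form by blast
    obtain k a where a: "\<not> f dvd a" "incl C \<asymp> F ^ k * incl a" using incl_factor by blast
    obtain Q where Q: "incl a * Q \<asymp> 1" using invertible_incl[OF a(1)] by (auto simp: invertible_def)
    have eq: "U * P \<asymp> U * (F ^ k * incl a)" using C eqv_mult_left[OF a(2)] by (rule eqv_trans)
    hence "Q * (U * P) \<asymp> Q * (U * (F ^ k * incl a))" by (rule eqv_mult_left)
    also have "\<dots> = U * F ^ k * (incl a * Q)" by (simp add: mult_ac)
    also have "U * F ^ k * (incl a * Q) \<asymp> U * F ^ k * 1" using Q by (rule eqv_mult_left)
    finally have "cls n c (U * F ^ k) \<in> I" using transport I_rules(3)[OF P] by simp
    hence "F ^ k = F ^ (k - \<mu>) * F ^ \<mu>" using \<mu>_min by (simp flip: power_add)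
    hence "U * (F ^ k * incl a) = (F ^ (k - \<mu>) * incl a) * (U * F ^ \<mu>)" by (simp add: mult_ac)
    thus ?thesis using eq by metis
  qed
  \<comment> \<open>The same argument applied to the part without \<open>u\<close> shows that \<open>F^l\<close> divides it.\<close>
  have gens: "\<exists>a b. P \<asymp> a * (F ^ l + U * incl h) + b * (U * F ^ \<mu>)" if P: "cls n c P \<in> I" for P
  proof -
    obtain A B where AB: "P \<asymp> incl A + U * incl B" using normal_form by blast
    obtain k a where a: "\<not> f dvd a" "incl A \<asymp> F ^ k * incl a" using incl_factor by blast
    obtain Q where Q: "incl a * Q \<asymp> 1" using invertible_incl[OF a(1)] by (auto simp: invertible_def)
    have P_eq: "P \<asymp> F ^ k * incl a + U * incl B"
      using AB eqv_add[OF a(2) eqv_refl] by (rule eqv_trans)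
    obtain C where C: "U * (incl B * Q) \<asymp> U * incl C" using U_mult_normal_form by blast
    have "Q * P \<asymp> Q * (F ^ k * incl a + U * incl B)" using P_eq by (rule eqv_mult_left)
    also have "\<dots> = F ^ k * (incl a * Q) + U * (incl B * Q)" by (simp add: algebra_simps)
    also have "F ^ k * (incl a * Q) + U * (incl B * Q) \<asymp> F ^ k * 1 + U * incl C"
      by (rule eqv_add[OF eqv_mult_left[OF Q] C])
    finally have "cls n c (F ^ k + U * incl C) \<in> I" using transport I_rules(3)[OF P] by simp
    hence "is_order k" by (auto simp: is_order_def)
    hence k: "F ^ k = F ^ (k - l) * F ^ l" using l_min by (simp flip: power_add)
    let ?x = "F ^ (k - l) * incl a" and ?g = "F ^ l + U * incl h"
    have "F ^ k * incl a + U * incl B - ?x * ?g = U * (incl B - ?x * incl h)"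
      by (simp add: k algebra_simps)
    moreover have "cls n c (F ^ k * incl a + U * incl B - ?x * ?g) \<in> I"
      using transport[OF P_eq P] I_rules(3,4) h by blast
    ultimately obtain b where "F ^ k * incl a + U * incl B - ?x * ?g \<asymp> b * (U * F ^ \<mu>)"
      using torsion by metis
    hence "?x * ?g + (F ^ k * incl a + U * incl B - ?x * ?g) \<asymp> ?x * ?g + b * (U * F ^ \<mu>)"
      by (intro eqv_add) auto
    hence "F ^ k * incl a + U * incl B \<asymp> ?x * ?g + b * (U * F ^ \<mu>)" by simp
    thus ?thesis using P_eq eqv_trans by blast
  qed
  show thesis
    using that[OF l_le \<mu>_min[OF U_l] h \<mu>_mem \<mu>_min torsion gens] .
qed

text \<open>
  The part of the first generator divisible by \<open>u\<close> matters only modulo the second generator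
  \<open>u F^\<mu>\<close>, so it can be replaced by the first \<open>\<mu>\<close> digits of its expansion. For \<open>l = N\<close> the image
  modulo \<open>u\<close> is zero, and the first generator is superfluous.
\<close>
lemma ideal_generators:
  assumes I: "ideal I (cc_ring n c)"
  obtains l \<mu> a b d where "l \<le> N" "\<mu> \<le> l"
    "I = gen n c {F ^ l + U * fsum a0 \<mu> a b d, U * F ^ \<mu>}"
    "l = N \<Longrightarrow> I = gen n c {U * F ^ \<mu>}"
    "\<mu> \<le> tors n c a0 (F ^ l + U * fsum a0 \<mu> a b d)"
proof -
  note I_rules = ideal_representatives[OF I]
  obtain l \<mu> h where l: "l \<le> N" "\<mu> \<le> l"
    and mem: "cls n c (F ^ l + U * incl h) \<in> I" "cls n c (U * F ^ \<mu>) \<in> I"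
    and \<mu>_min: "\<And>i. cls n c (U * F ^ i) \<in> I \<Longrightarrow> \<mu> \<le> i"
    and torsion: "\<And>P. cls n c (U * P) \<in> I \<Longrightarrow> \<exists>b. U * P \<asymp> b * (U * F ^ \<mu>)"
    and gens: "\<And>P. cls n c P \<in> I \<Longrightarrow> \<exists>a b. P \<asymp> a * (F ^ l + U * incl h) + b * (U * F ^ \<mu>)"
    using ideal_structure[OF I] by blast
  obtain a b d r where h: "incl h = fsum a0 \<mu> a b d + F ^ \<mu> * incl r"
    using adic_expansion by blast
  define S where "S = fsum a0 \<mu> a b d"
  let ?g = "F ^ l + U * S"
  have g: "F ^ l + U * incl h = ?g + incl r * (U * F ^ \<mu>)"
    by (simp add: h S_def algebra_simps)
  hence "?g = F ^ l + U * incl h - incl r * (U * F ^ \<mu>)" by simp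
  hence g_mem: "cls n c ?g \<in> I" using mem I_rules by metis
  have I_eq: "I = gen n c {?g, U * F ^ \<mu>}"
  proof (rule ideal_eq_gen_pair[OF I g_mem mem(2)])
    fix P assume "cls n c P \<in> I"
    then obtain x y where "P \<asymp> x * (F ^ l + U * incl h) + y * (U * F ^ \<mu>)" using gens by blast
    also have "\<dots> = x * (?g + incl r * (U * F ^ \<mu>)) + y * (U * F ^ \<mu>)" by (simp only: g)
    also have "\<dots> = x * ?g + (x * incl r + y) * (U * F ^ \<mu>)"
      by (simp only: distrib_left distrib_right mult_ac add_ac)
    finally show "\<exists>a b. P \<asymp> a * ?g + b * (U * F ^ \<mu>)" by blast
  qed
  have "I = gen n c {U * F ^ \<mu>}" if "l = N"
  proof -
    have eq: "?g \<asymp> U * S" using that eqv_add[OF F_power_N, of "U * S" "U * S"] by simp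
    hence "cls n c (U * S) \<in> I" using g_mem by (simp add: eqv_cls)
    then obtain b where "U * S \<asymp> b * (U * F ^ \<mu>)" using torsion by blast
    hence "cls n c ?g \<in> gen n c {U * F ^ \<mu>}" using eq eqv_trans unfolding mem_gen_single by blast
    hence "gen n c {U * F ^ \<mu>, ?g} = gen n c {U * F ^ \<mu>}" by (rule gen_pair_absorb)
    moreover have "{?g, U * F ^ \<mu>} = {U * F ^ \<mu>, ?g}" by (rule insert_commute)
    ultimately show ?thesis using I_eq by (simp only:)
  qed
  moreover have "\<mu> \<le> tors n c a0 ?g"
  proof (rule \<mu>_min)
    obtain x where "U * F ^ tors n c a0 ?g \<asymp> x * ?g"
      using tors_mem by (auto simp: mem_gen_single)
    thus "cls n c (U * F ^ tors n c a0 ?g) \<in> I" using I_rules(3)[OF g_mem] by (simp add: eqv_cls)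
  qed
  ultimately show thesis using that[OF l] I_eq unfolding S_def by blast
qed

subsection \<open>Truncated expansions as a power times a unit\<close>

text \<open>
  A truncated expansion is either zero, represented by \<open>z = 0\<close> with \<open>t = 0\<close> (which is where \<open>0 < l\<close>
  enters), or a power of \<open>F\<close> times a unit.
\<close>
lemma fsum_as_z:
  assumes "0 < l" "\<mu> \<le> l"
  obtains t z where "t < l" "fsum a0 \<mu> a b d = F ^ t * z" "z_cond n c a0 (\<mu> - t) z"
proof -
  consider "fsum a0 \<mu> a b d = F ^ 0 * 0"
    | t where "t < \<mu>" "quad (a t) (b t) (d t) \<noteq> 0"
        "fsum a0 \<mu> a b d = F ^ t * fsum a0 (\<mu> - t) (\<lambda>i. a (i + t)) (\<lambda>i. b (i + t)) (\<lambda>i. d (i + t))"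
    using fsum_factor[of a0 \<mu> a b d] by auto
  thus thesis
  proof cases
    case 1
    thus thesis using that assms(1) by (auto simp: z_cond_def)
  next
    case 2
    let ?z = "fsum a0 (\<mu> - t) (\<lambda>i. a (i + t)) (\<lambda>i. b (i + t)) (\<lambda>i. d (i + t))"
    obtain A where "?z = incl A" "\<not> f dvd A"
      using fsum_eq_cubic_dvd[of "\<mu> - t" "\<lambda>i. a (i + t)" "\<lambda>i. b (i + t)" "\<lambda>i. d (i + t)" a0] 2 by auto
    hence "cls n c ?z \<in> Units (cc_ring n c)" using invertible_Units invertible_incl by metis
    hence "z_cond n c a0 (\<mu> - t) ?z"
      unfolding z_cond_def using 2(2)
      by (intro disjI2 conjI exI[of _ "\<lambda>i. a (i + t)"] exI[of _ "\<lambda>i. b (i + t)"]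
          exI[of _ "\<lambda>i. d (i + t)"]) auto
    thus thesis using that[of t ?z] 2 assms by auto
  qed
qed

lemma z_as_fsum:
  assumes "z_cond n c a0 (\<mu> - t) z"
  shows "\<exists>a b d. F ^ t * z = fsum a0 \<mu> a b d"
proof (cases "z = 0")
  case True
  have "F ^ t * z = fsum a0 \<mu> (\<lambda>_. 0) (\<lambda>_. 0) (\<lambda>_. 0)" using True by (simp add: fsum_def)
  thus ?thesis by blast
next
  case False
  then obtain z0 z1 z2 where z: "z = fsum a0 (\<mu> - t) z0 z1 z2"
    using assms by (auto simp: z_cond_def)
  hence "t < \<mu>" using False by (cases "t < \<mu>") (auto simp: fsum_def)
  thus ?thesis using fsum_shift[of a0 t "\<mu> - t" z0 z1 z2] z by simp
qed

subsection \<open>The four types of ideals\<close>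

lemma typeD_eq_typeD': "typeD p s c a0 = typeD' p s c a0"
proof (intro equalityI subsetI)
  fix I assume "I \<in> typeD p s c a0"
  then obtain l \<mu> a b d where I: "I = gen n c {F ^ l + U * fsum a0 \<mu> a b d, U * F ^ \<mu>}"
    and l: "l \<le> N - 1" and \<mu>: "\<mu> < tors n c a0 (F ^ l + U * fsum a0 \<mu> a b d)"
    unfolding typeD_def by blast
  have "\<mu> < l" using \<mu> tors_le order_less_le_trans by blast
  then obtain t z where z: "t < l" "fsum a0 \<mu> a b d = F ^ t * z" "z_cond n c a0 (\<mu> - t) z"
    using fsum_as_z[of l \<mu> a b d] by auto
  thus "I \<in> typeD' p s c a0"
    using I l \<mu> unfolding typeD'_def z(2) mult.assoc[symmetric] by blast
next
  fix I assume "I \<in> typeD' p s c a0"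
  then obtain l t z \<mu> where I: "I = gen n c {F ^ l + U * F ^ t * z, U * F ^ \<mu>}"
    and l: "l \<le> N - 1" and z: "z_cond n c a0 (\<mu> - t) z"
    and \<mu>: "\<mu> < tors n c a0 (F ^ l + U * F ^ t * z)"
    unfolding typeD'_def by blast
  obtain a b d where "F ^ t * z = fsum a0 \<mu> a b d" using z_as_fsum[OF z] by blast
  hence eq: "U * F ^ t * z = U * fsum a0 \<mu> a b d" by (simp add: mult.assoc)
  show "I \<in> typeD p s c a0"
    using I l \<mu> unfolding typeD_def eq by blast
qed

text \<open>
  Suppose that the ideal generated by \<open>g = F^l + u h\<close> and \<open>u F^\<mu>\<close> is generated by one element \<open>G\<close>,
  and write \<open>g = e G\<close>. If \<open>e\<close> is a unit, then \<open>g\<close> generates the ideal too, which contains \<open>u F^\<mu>\<close>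
  although \<open>\<mu>\<close> is smaller than the torsion exponent of \<open>g\<close>. Otherwise \<open>e\<close> is a multiple of \<open>F\<close>
  modulo \<open>u\<close>; as \<open>G\<close> is a multiple of \<open>F^l\<close> modulo \<open>u\<close>, the power \<open>F^l\<close> is then a multiple of
  \<open>F^(l+1)\<close> modulo \<open>u\<close>, and thus zero modulo \<open>u\<close>, which is impossible for \<open>l < N\<close>.
\<close>
lemma typeD_not_principal:
  assumes "I \<in> typeD p s c a0"
  shows "\<not> principalideal I (cc_ring n c)"
proof
  assume "principalideal I (cc_ring n c)"
  then obtain G' where "G' \<in> carrier (cc_ring n c)" "I = Idl\<^bsub>cc_ring n c\<^esub> {G'}"
    using principalideal.generate by blast
  then obtain G where I_G: "I = gen n c {G}"
    by (auto simp: carrier_cc_ring gen_def)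
  obtain l \<mu> a b d where I: "I = gen n c {F ^ l + U * fsum a0 \<mu> a b d, U * F ^ \<mu>}"
    and l: "l \<le> N - 1" and \<mu>: "\<mu> < tors n c a0 (F ^ l + U * fsum a0 \<mu> a b d)"
    using assms unfolding typeD_def by blast
  define h where "h = fsum a0 \<mu> a b d"
  let ?g = "F ^ l + U * h"
  have "cls n c ?g \<in> gen n c {G}" "cls n c G \<in> gen n c {?g, U * F ^ \<mu>}"
    using gen_mem I I_G by (metis h_def)+
  then obtain e x y where e: "?g \<asymp> e * G" and G: "G \<asymp> x * ?g + y * (U * F ^ \<mu>)"
    by (auto simp: mem_gen_pair mem_gen_single)
  obtain A B where AB: "e \<asymp> incl A + U * incl B" using normal_form by blast
  show False
  proof (cases "f dvd A")
    case False
    then obtain Q where "(incl A + U * incl B) * Q \<asymp> 1"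
      using invertible_normal_form[of A "incl B"] by (auto simp: invertible_def)
    hence Q: "e * Q \<asymp> 1" using eqv_trans[OF eqv_mult_right[OF AB]] by blast
    have "Q * ?g \<asymp> Q * (e * G)" using e by (rule eqv_mult_left)
    also have "\<dots> = e * Q * G" by (simp add: mult_ac)
    also have "e * Q * G \<asymp> 1 * G" using Q by (rule eqv_mult_right)
    finally have "cls n c G \<in> gen n c {?g}" using eqv_sym by (auto simp: mem_gen_single)
    hence "I \<subseteq> gen n c {?g}" unfolding I_G by (rule gen_single_subset)
    moreover have "cls n c (U * F ^ \<mu>) \<in> I" unfolding I by (rule gen_mem)
    ultimately have "tors n c a0 ?g \<le> \<mu>" unfolding tors_def by (blast intro: Least_le)
    thus False using \<mu> by (simp add: h_def)
  next
    case True
    then obtain A' where "A = f * A'" by (auto elim: dvdE)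
    hence A: "incl A = F * incl A'" by (simp only: incl_mult incl_cubic)
    let ?E = "F * incl A' + U * incl B"
    \<comment> \<open>Expanding \<open>?g = ?E * (x * ?g + y * (U * F ^ \<mu>))\<close>, all terms with a factor \<open>u\<close> are gathered in \<open>U * ?Z\<close>.\<close>
    let ?Z = "incl B * (x * ?g + y * (U * F ^ \<mu>)) + F * incl A' * (x * h + y * F ^ \<mu>) - h"
    have "?g \<asymp> ?E * (x * ?g + y * (U * F ^ \<mu>))"
      using eqv_trans[OF e eqv_mult[OF AB G]] by (simp only: A)
    hence "?g - ?E * (x * ?g + y * (U * F ^ \<mu>)) \<asymp> 0" by (simp only: eqv_diff_0)
    moreover have "?g - ?E * (x * ?g + y * (U * F ^ \<mu>)) = (1 - F * (incl A' * x)) * F ^ l - U * ?Z"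
      by (simp add: algebra_simps)
    ultimately have eq: "(1 - F * (incl A' * x)) * F ^ l \<asymp> U * ?Z" by (simp only: eqv_diff_0)
    obtain Q where Q: "(1 - F * (incl A' * x)) * Q \<asymp> 1"
      using invertible_one_minus by (auto simp: invertible_def)
    have "F ^ l = 1 * F ^ l" by simp
    also have "1 * F ^ l \<asymp> (1 - F * (incl A' * x)) * Q * F ^ l"
      using eqv_sym[OF Q] by (rule eqv_mult_right)
    also have "\<dots> = Q * ((1 - F * (incl A' * x)) * F ^ l)" by (simp only: mult_ac)
    also have "Q * ((1 - F * (incl A' * x)) * F ^ l) \<asymp> Q * (U * ?Z)" using eq by (rule eqv_mult_left)
    also have "\<dots> = U * (Q * ?Z)" by (simp only: mult_ac)
    finally have "N \<le> l" by (rule F_power_eqv_U_mult)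
    thus False using l N_pos by linarith
  qed
qed

text \<open>
  The exponents \<open>l\<close> and \<open>\<mu>\<close> of an ideal decide its type: \<open>l = N\<close> means that all its elements are
  multiples of \<open>u\<close>, and \<open>l = 0\<close> that it contains a unit. In between, \<open>\<mu>\<close> is compared with the
  torsion exponent of the first generator. If they agree, the second generator is redundant.
\<close>
lemma ideals_eq:
  "{I. ideal I (cc_ring n c)} = typeA p s c \<union> typeB p s c a0 \<union> typeC p s c a0 \<union> typeD p s c a0"
proof (intro equalityI subsetI)
  fix I assume "I \<in> {I. ideal I (cc_ring n c)}"
  hence ideal: "ideal I (cc_ring n c)" by simp
  then obtain l \<mu> a b d where l: "l \<le> N" "\<mu> \<le> l"
    and I: "I = gen n c {F ^ l + U * fsum a0 \<mu> a b d, U * F ^ \<mu>}"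
    and I_N: "l = N \<Longrightarrow> I = gen n c {U * F ^ \<mu>}"
    and tors: "\<mu> \<le> tors n c a0 (F ^ l + U * fsum a0 \<mu> a b d)"
    using ideal_generators by blast
  let ?g = "F ^ l + U * fsum a0 \<mu> a b d"
  consider "l = N" "\<mu> = N" | "l = N" "\<mu> < N" | "l = 0" | "0 < l" "l < N" "\<mu> < tors n c a0 ?g"
    | "0 < l" "l < N" "\<mu> = tors n c a0 ?g"
    using l tors by linarith
  thus "I \<in> typeA p s c \<union> typeB p s c a0 \<union> typeC p s c a0 \<union> typeD p s c a0"
  proof cases
    case 1
    have "U * F ^ N \<asymp> U * 0" using F_power_N by (rule eqv_mult_left)
    hence "cls n c (U * F ^ N) = cls n c 0" by (simp add: eqv_cls)
    hence "I = gen n c {0}" using 1 I_N by (simp add: gen_def)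
    thus ?thesis by (simp add: typeA_def)
  next
    case 2
    hence "I = gen n c {U * F ^ \<mu>}" "\<mu> \<le> N - 1" using I_N by auto
    thus ?thesis unfolding typeB_def by blast
  next
    case 3
    have "?g * (1 - U * fsum a0 \<mu> a b d) = 1 - U * U * (fsum a0 \<mu> a b d * fsum a0 \<mu> a b d)"
      using 3 by (simp add: algebra_simps)
    hence "?g * (1 - U * fsum a0 \<mu> a b d) = 1" by (simp add: U_sq)
    moreover have "cls n c ?g \<in> I" unfolding I by (rule gen_mem)
    ultimately have one: "cls n c 1 \<in> I" using ideal_representatives(3)[OF ideal] by (metis mult.commute)
    have "I = gen n c {1, 1}"
    proof (rule ideal_eq_gen_pair[OF ideal one one])
      fix P
      have "P \<asymp> P * 1 + 0 * 1" by simp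
      thus "\<exists>a b. P \<asymp> a * 1 + b * 1" by blast
    qed
    thus ?thesis by (simp add: typeA_def)
  next
    case 4
    hence "l \<le> N - 1" by simp
    thus ?thesis using I 4 unfolding typeD_def by blast
  next
    case 5
    have "I = gen n c {?g}"
      unfolding I by (rule gen_pair_absorb) (use 5 tors_mem in metis)
    moreover obtain t z where z: "t < l" "fsum a0 \<mu> a b d = F ^ t * z" "z_cond n c a0 (\<mu> - t) z"
      using fsum_as_z[OF 5(1) l(2)] by blast
    ultimately have "I = gen n c {F ^ l + U * F ^ t * z}" by (simp add: mult.assoc)
    moreover have "1 \<le> l" "l \<le> N - 1" using 5 by auto
    ultimately show ?thesis using z unfolding typeC_def by blast
  qed
next
  fix I assume "I \<in> typeA p s c \<union> typeB p s c a0 \<union> typeC p s c a0 \<union> typeD p s c a0"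
  hence "\<exists>G. I = gen n c G"
    unfolding typeA_def typeB_def typeC_def typeD_def by blast
  thus "I \<in> {I. ideal I (cc_ring n c)}" using gen_ideal by auto
qed

end

theorem theorem4p1:
  fixes p m s q0 r0 :: nat
    and \<alpha>0 \<alpha>1 \<alpha>3 \<alpha>4 :: "'a::field"
    and \<alpha> :: "'a fuv"
  assumes "prime p" and "p \<noteq> 3" and "m > 0" and "s > 0"
    and "card (UNIV :: 'a set) = p ^ m"
    and "s = q0 * m + r0" and "r0 \<le> m - 1"
    and "\<alpha>1 \<noteq> 0" and "\<alpha>3 \<noteq> 0" and "\<alpha>4 \<noteq> 0"
    and "\<alpha>0 = \<alpha>1 ^ (p ^ (m - r0))"
    and "\<alpha> = emb \<alpha>1 + emb \<alpha>3 * v_elt + emb \<alpha>4 * u_elt * v_elt"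
    and "\<not> (\<exists>\<beta> :: 'a fuv. \<beta> ^ 3 = \<alpha>)"
  shows "{I. ideal I (cc_ring (3 * p ^ s) \<alpha>)}
           = typeA p s \<alpha> \<union> typeB p s \<alpha> \<alpha>0 \<union> typeC p s \<alpha> \<alpha>0 \<union> typeD p s \<alpha> \<alpha>0
       \<and> typeD p s \<alpha> \<alpha>0 = typeD' p s \<alpha> \<alpha>0
       \<and> (\<forall>I \<in> typeD p s \<alpha> \<alpha>0. \<not> principalideal I (cc_ring (3 * p ^ s) \<alpha>))"
proof -
  have char: "CHAR('a) = p" using assms by (intro CHAR_of_card_prime_power)
  have finite: "finite (UNIV :: 'a set)"
    using assms(1,5) by (metis card.infinite power_not_zero not_prime_0)
  have frobenius: "x ^ (p ^ m) = x" for x :: 'a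
    using finite_field_power_card[OF finite, of x] assms(5) by simp
  have iterate: "x ^ (p ^ (k * m)) = x" for x :: 'a and k
  proof (induction k)
    case (Suc k)
    have "x ^ (p ^ (Suc k * m)) = (x ^ (p ^ m)) ^ (p ^ (k * m))"
      by (simp add: power_add flip: power_mult)
    thus ?case using Suc by (simp add: frobenius)
  qed simp
  \<comment> \<open>The exponents add up to a multiple of \<open>m\<close>, and \<open>x \<mapsto> x ^ (p ^ m)\<close> is the identity of the field.\<close>
  have "m - r0 + s = Suc q0 * m" using assms(3,6,7) by simp
  hence "\<alpha>0 ^ (p ^ s) = \<alpha>1 ^ (p ^ (Suc q0 * m))"
    unfolding assms(11) by (metis power_add power_mult)
  hence power: "\<alpha>0 ^ (p ^ s) = \<alpha>1" by (simp only: iterate)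
  \<comment> \<open>A cube root of \<open>\<alpha>0\<close> gives one of \<open>\<alpha>1\<close>, which lifts to a cube root of \<open>\<alpha>\<close> because \<open>p \<noteq> 3\<close>.\<close>
  have not_cube: "\<nexists>b. b ^ 3 = \<alpha>0"
  proof
    assume "\<exists>b. b ^ 3 = \<alpha>0"
    then obtain b where b: "b ^ 3 = \<alpha>0" by blast
    have "(b ^ (p ^ s)) ^ 3 = \<alpha>1" using power b by (metis power_mult mult.commute)
    moreover from this have "b ^ (p ^ s) \<noteq> 0" using assms(8) by auto
    moreover have "(3 :: 'a) \<noteq> 0"
    proof
      assume "(3 :: 'a) = 0"
      hence "of_nat 3 = (0 :: 'a)" by simp
      hence "p dvd 3" unfolding of_nat_eq_0_iff_char_dvd char .
      thus False using assms(1,2) by (simp add: primes_dvd_imp_eq)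
    qed
    ultimately show False using cube_in_fuv assms(12,13) by metis
  qed
  interpret cubic_constacyclic p s \<alpha>0 \<alpha>1 \<alpha>3 \<alpha>4
    by unfold_locales (use assms char power not_cube in auto)
  have "\<alpha> = c" using assms(12) by (simp add: c_def)
  thus ?thesis using ideals_eq typeD_eq_typeD' typeD_not_principal by simp
qed

end
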